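(* Let $m\geq 1$ and let $(V_l)_{l=1}^m$ be a family of $m$ finite sets with $\# V_l=d_ln_l+1$, where $d_l\geq 1$ and $n_l\geq 1$, $l=1,\ldots,m$, are positive integers. Write $n=n_1+\cdots+n_m$. Suppose that $(B_i)_{i\in I}$ is a finite closed cover of $$Y=\Delta(V_1)\times\cdots\times\Delta(V_m)$$ such that any point of $Y$ lies in at most $n$ of the sets $B_i$. Then for some $i\in I$ and $l\in\{1,\ldots,m\}$ the projection of $B_i$ to the $l$th factor $\Delta(V_l)$ meets each of the codimension $d_l$ simplices $\Delta_T$ for $T\in\mathcal S_{d_l}(V_l)$.
   Context: For a finite set $V$: $\mathbb R[V]$ is the real vector space of maps $t:V\to\mathbb R$, and $\Delta(V)\subseteq\mathbb R[V]$ is the simplex of maps $t$ with $t(v)\geq 0$ for all $v\in V$ and $\sum_v t(v)=1$. The support of $t\in\mathbb R[V]$ is the set of $v\in V$ with $t(v)\neq 0$. For an integer $d$ with $0\leq d\leq\# V$, $\mathcal S_d(V)$ is the set of finite subsets $T$ of $\Delta(V)$ such that any two (distinct) elements of $T$ have disjoint supports and $\# V-\# T=d$. For $T\in\mathcal S_d(V)$, $\Delta_T$ denotes the convex hull of $T$; it is a simplex of codimension $d$ in $\Delta(V)$. *)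

theory Defs
  imports "HOL-Analysis.Analysis" "HOL-Library.Function_Algebras"
begin

text \<open>
  The maps from a set to \<^typ>\<open>real\<close> form a real vector space under pointwise operations;
  with this instance the library's \<^const>\<open>convex\<close> and \<^const>\<open>hull\<close> apply to
  sets of maps.
\<close>

instantiation "fun" :: (type, real_vector) real_vector
begin

definition scaleR_fun :: "real \<Rightarrow> ('a \<Rightarrow> 'b) \<Rightarrow> 'a \<Rightarrow> 'b"
  where "scaleR_fun c f = (\<lambda>x. c *\<^sub>R f x)"

instance
  by standard (simp_all add: scaleR_fun_def plus_fun_def fun_eq_iff algebra_simps)

end

text \<open>
  A map on a finite set \<open>V\<close> is represented by its extension by \<open>0\<close> to the ambient type. On the
  resulting finite-dimensional space the topology of \<^typ>\<open>'a \<Rightarrow> real\<close> (pointwise convergence) is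
  the Euclidean one.
\<close>

definition maps_on :: "'a set \<Rightarrow> ('a \<Rightarrow> real) set"
  where "maps_on V = {t. \<forall>v. v \<notin> V \<longrightarrow> t v = 0}"

definition std_simplex :: "'a set \<Rightarrow> ('a \<Rightarrow> real) set"
  where "std_simplex V = {t \<in> maps_on V. (\<forall>v\<in>V. 0 \<le> t v) \<and> (\<Sum>v\<in>V. t v) = 1}"

text \<open>
  The family \<open>\<S>\<^sub>d(V)\<close>; the condition \<open>#V - #T = d\<close> is written without truncated subtraction.
\<close>

definition disj_supp_sets :: "nat \<Rightarrow> 'a set \<Rightarrow> ('a \<Rightarrow> real) set set"
  where "disj_supp_sets d V =
    {T. finite T \<and> T \<subseteq> std_simplex V \<and>
        pairwise (\<lambda>s t. disjnt (support_on V s) (support_on V t)) T \<and>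
        card T + d = card V}"

end

theory Submission
  imports Defs "HOL-Library.Z2" "HOL-Combinatorics.Permutations"
begin

text \<open>
  Suppose that every \<open>B i\<close> misses, in each factor \<open>l\<close>, the hull of some \<open>T\<close> in
  \<^term>\<open>disj_supp_sets (d l) (V l)\<close>. The elements of \<open>T\<close> have disjoint supports, so a signed map \<open>t\<close>
  lies in the linear span of \<open>T\<close> exactly when \<open>d l\<close> linear functionals vanish at \<open>t\<close>, and a nonzero
  signed combination of \<open>T\<close> becomes, after taking absolute values and normalising, a point of the
  hull of \<open>T\<close> (\<open>odd_functionals_cutting_out_hull\<close>). So replace each simplex by the sphere of
  signed maps on \<open>V l\<close>, of dimension \<open>d l * n l\<close>, pull the cover back along
  \<open>t \<mapsto> \<bar>t\<bar> / (\<Sum>u. \<bar>t u\<bar>)\<close>, and obtain over each \<open>B i\<close> and for each \<open>l\<close> an odd map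
  to \<open>d l\<close>-dimensional space without zeros.

  These local maps are combined by levels. Thicken the sets slightly, keeping the multiplicity at most
  \<open>n = (\<Sum>l. n l)\<close>, and let \<open>\<phi> i\<close> be continuous and positive exactly on the thickened \<open>B i\<close>. For
  each \<open>k \<le> n\<close>, at a given point at most one index set \<open>J\<close> of size \<open>k\<close> consists of the \<open>k\<close>
  indices with the strictly largest values of \<open>\<phi>\<close>, all of them nonzero, and for some \<open>k\<close> there is one, namely
  the set of all \<open>i\<close> with \<open>\<phi> i > 0\<close>. The weights \<open>top_weight\<close> single out this set
  continuously. Devote \<open>n l\<close> of the \<open>n\<close> levels to the factor \<open>l\<close>, and at such a level use the \<open>d l\<close>
  functionals of factor \<open>l\<close> that belong to one chosen element of \<open>J\<close>. Altogether this gives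
  \<open>d l * n l\<close> real functions that are odd in the \<open>l\<close>-th sphere and even in the others, for each \<open>l\<close>,
  without a common zero.

  A Borsuk--Ulam theorem for products of spheres (\<open>block_Borsuk_Ulam\<close>) forbids this. It is
  proved on the cube, whose coordinates fall into blocks: an upper hemisphere of each sphere is a
  cube, and oddness becomes a condition relating boundary points that differ by a sign in one block. For
  sign patterns on a triangulated grid, count modulo 2 the maximal simplices whose \<open>k\<close>-th edge changes
  the \<open>k\<close>-th sign for every \<open>k\<close> (\<open>sign_degree\<close>). This count is a discrete integral of a product of
  exact 1-forms, so it depends only on the boundary condition
  (\<open>sign_degree_eq_of_twisted\<close>), and for one explicit pattern it is 1
  (\<open>sign_degree_first_facet\<close>). Refining the grid turns simplices with sign changes into a common
  zero.
\<close>

section \<open>Sign patterns on a triangulated grid\<close>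

(* These rules turn sums and products in the two-element field into bitwise operations, to which the
   ring lemmas do not apply. *)
declare add_bit_eq_xor [simp del] mult_bit_eq_and [simp del]

lemma bit_add_self [simp]: "(x::bit) + x = 0"
  by (cases x) simp_all

lemma sum_bit_fixpoint_free_involution:
  fixes f :: "'c \<Rightarrow> bit"
  assumes "finite A"
    and "\<And>x. x \<in> A \<Longrightarrow> h x \<in> A" "\<And>x. x \<in> A \<Longrightarrow> h (h x) = x"
    and "\<And>x. x \<in> A \<Longrightarrow> h x \<noteq> x" "\<And>x. x \<in> A \<Longrightarrow> f (h x) = f x"
  shows "sum f A = 0"
  using assms
proof (induction A rule: finite_psubset_induct)
  case (psubset A)
  show ?case
  proof (cases "A = {}")
    case False
    then obtain x where x: "x \<in> A" by blast
    let ?A = "A - {x, h x}"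
    have "sum f ?A = 0"
    proof (rule psubset.IH)
      show "h y \<in> ?A" if "y \<in> ?A" for y
        using that psubset.prems x by (metis DiffE DiffI insertCI insertE singletonD)
    qed (use x psubset.prems in auto)
    moreover have "sum f A = sum f ?A + sum f {x, h x}"
      using x psubset by (intro sum.subset_diff) auto
    moreover have "sum f {x, h x} = f x + f x"
      using x psubset.prems(3,4)[OF x] by simp
    ultimately show ?thesis by simp
  qed simp
qed

definition grid :: "nat \<Rightarrow> int \<Rightarrow> (nat \<Rightarrow> int) set" where
  "grid N p = {x. (\<forall>j<N. \<bar>x j\<bar> \<le> p) \<and> (\<forall>j\<ge>N. x j = 0)}"

text \<open>
  The antipodal map of the sphere belonging to block \<open>l\<close>; the blocks are the fibres of \<open>b\<close>.
\<close>
definition block_flip :: "(nat \<Rightarrow> 'b) \<Rightarrow> 'b \<Rightarrow> (nat \<Rightarrow> 'c::uminus) \<Rightarrow> nat \<Rightarrow> 'c" where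
  "block_flip b l x = (\<lambda>j. if b j = l then - x j else x j)"

text \<open>
  The maximal simplices of Todd's triangulation J1, with ordered vertices: a path from an
  all-even vertex \<open>a\<close> to an all-odd vertex \<open>c\<close> of the same unit cube, moving coordinate \<open>j\<close> at
  step \<open>r j\<close>. Ordering the vertices from even to odd makes the reflections \<open>x j \<mapsto> - x j\<close> preserve
  the triangulation together with its vertex orders, which the translation-invariant
  subdivision of the cubes would not do.
\<close>
definition flags :: "nat \<Rightarrow> int \<Rightarrow> ((nat \<Rightarrow> int) \<times> (nat \<Rightarrow> int) \<times> (nat \<Rightarrow> nat)) set" where
  "flags N p = {(a, c, r). a \<in> grid N p \<and> c \<in> grid N p \<and> r permutes {..<N} \<and>
     (\<forall>j<N. even (a j) \<and> odd (c j) \<and> \<bar>c j - a j\<bar> = 1)}"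

fun vert :: "(nat \<Rightarrow> int) \<times> (nat \<Rightarrow> int) \<times> (nat \<Rightarrow> nat) \<Rightarrow> nat \<Rightarrow> nat \<Rightarrow> int" where
  "vert (a, c, r) k = (\<lambda>j. if r j < k then c j else a j)"

text \<open>
  The cup product of the coboundaries of \<open>s 0\<close>, ..., \<open>s (N - 1)\<close>, evaluated on the fundamental chain of
  the grid.
\<close>
definition sign_degree :: "nat \<Rightarrow> int \<Rightarrow> (nat \<Rightarrow> (nat \<Rightarrow> int) \<Rightarrow> bit) \<Rightarrow> bit" where
  "sign_degree N p s = (\<Sum>z\<in>flags N p. \<Prod>k<N. s k (vert z k) + s k (vert z (Suc k)))"

lemma finite_grid: "finite (grid N p)"
proof (rule finite_subset)
  show "grid N p \<subseteq> {x. \<forall>j. (j \<in> {..<N} \<longrightarrow> x j \<in> {-p..p}) \<and> (j \<notin> {..<N} \<longrightarrow> x j = 0)}"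
    by (force simp: grid_def abs_le_iff)
  show "finite {x. \<forall>j. (j \<in> {..<N} \<longrightarrow> x j \<in> {-p..p}) \<and> (j \<notin> {..<N} \<longrightarrow> x j = 0)}"
    by (rule finite_set_of_finite_funs) auto
qed

lemma finite_flags: "finite (flags N p)"
proof (rule finite_subset)
  show "flags N p \<subseteq> grid N p \<times> grid N p \<times> {r. r permutes {..<N}}"
    by (auto simp: flags_def)
qed (auto simp: finite_grid finite_permutations)

lemma vert_in_grid:
  assumes "z \<in> flags N p" shows "vert z k \<in> grid N p"
  using assms by (cases z) (auto simp: flags_def grid_def)

text \<open>
  This is why the half-width \<open>p\<close> is taken even: a vertex of a flag touches a facet of the grid only
  through coordinates that have not moved yet.
\<close>
lemma flags_odd_interior:
  assumes "(a, c, r) \<in> flags N p" "even p" "j < N"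
  shows "\<bar>c j\<bar> \<noteq> p" and "\<bar>c j\<bar> < p"
proof -
  have "odd (c j)" "\<bar>c j\<bar> \<le> p" using assms by (auto simp: flags_def grid_def)
  then show "\<bar>c j\<bar> \<noteq> p" "\<bar>c j\<bar> < p" using assms(2) by (metis dvd_abs_iff, metis dvd_abs_iff order_less_le)
qed

text \<open>
  The next three lemmas say that the fundamental chain is a relative cycle: a function of the face
  opposite to one vertex sums to zero, because every such face lies in two simplices. For an inner
  vertex the other simplex exchanges two consecutive steps.
\<close>
lemma sum_flags_inner_face:
  fixes F :: "(nat \<Rightarrow> nat \<Rightarrow> int) \<Rightarrow> bit"
  assumes "Suc i < N"
    and F: "\<And>v v'. (\<And>k. k \<noteq> Suc i \<Longrightarrow> v k = v' k) \<Longrightarrow> F v = F v'"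
  shows "(\<Sum>z\<in>flags N p. F (vert z)) = 0"
proof -
  let ?t = "Transposition.transpose i (Suc i)"
  define h where "h = (\<lambda>(a::nat \<Rightarrow> int, c::nat \<Rightarrow> int, r::nat \<Rightarrow> nat). (a, c, ?t \<circ> r))"
  have t: "?t permutes {..<N}" using assms(1) by (intro permutes_swap_id) auto
  show ?thesis
  proof (rule sum_bit_fixpoint_free_involution[where h = h])
    fix z assume z: "z \<in> flags N p"
    obtain a c r where [simp]: "z = (a, c, r)" by (cases z)
    have r: "r permutes {..<N}" using z by (simp add: flags_def)
    show "h z \<in> flags N p"
      using z permutes_compose[OF r t] by (auto simp: flags_def h_def)
    show "h (h z) = z" by (auto simp: h_def fun_eq_iff)
    obtain j where "r j = i" using r by (metis permutes_surj surjD)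
    then show "h z \<noteq> z" by (auto simp: h_def fun_eq_iff intro!: exI[of _ j])
    show "F (vert (h z)) = F (vert z)"
    proof (rule F)
      fix k assume "k \<noteq> Suc i"
      then have "?t n < k \<longleftrightarrow> n < k" for n
        by (auto simp: Transposition.transpose_def)
      then show "vert (h z) k = vert z k" by (simp add: h_def)
    qed
  qed (rule finite_flags)
qed

text \<open>
  Reflecting the moved coordinate of \<open>a\<close> about \<open>c\<close> gives the other simplex; it never leaves the grid because
  odd coordinates are interior.
\<close>
lemma sum_flags_first_face:
  fixes F :: "(nat \<Rightarrow> nat \<Rightarrow> int) \<Rightarrow> bit"
  assumes "0 < N" "even p"
    and F: "\<And>v v'. (\<And>k. k \<noteq> 0 \<Longrightarrow> v k = v' k) \<Longrightarrow> F v = F v'"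
  shows "(\<Sum>z\<in>flags N p. F (vert z)) = 0"
proof -
  define h where "h = (\<lambda>(a::nat \<Rightarrow> int, c::nat \<Rightarrow> int, r::nat \<Rightarrow> nat).
    (\<lambda>j. if r j = 0 then 2 * c j - a j else a j, c, r))"
  show ?thesis
  proof (rule sum_bit_fixpoint_free_involution[where h = h])
    fix z assume z: "z \<in> flags N p"
    obtain a c r where [simp]: "z = (a, c, r)" by (cases z)
    have r: "r permutes {..<N}" using z by (simp add: flags_def)
    have c: "\<bar>c j\<bar> < p" if "j < N" for j
      using flags_odd_interior(2)[of a c r N p j] z assms that by simp
    have out: "r j \<noteq> 0" if "j \<ge> N" for j
      using that r assms(1) permutes_not_in[OF r, of j] by auto
    have "\<bar>2 * c j - a j\<bar> \<le> p" if "j < N" for j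
    proof -
      have "\<bar>c j - a j\<bar> = 1" using z that by (auto simp: flags_def)
      then show ?thesis using c[OF that] by linarith
    qed
    then show "h z \<in> flags N p"
      using z out by (auto simp: flags_def h_def grid_def)
    show "h (h z) = z" by (auto simp: h_def fun_eq_iff)
    obtain j where j: "r j = 0" using r by (metis permutes_surj surjD)
    then have "j < N" using out by (meson not_le)
    then have "2 * c j - a j \<noteq> a j" using z by (auto simp: flags_def)
    then show "h z \<noteq> z" using j by (auto simp: h_def fun_eq_iff)
    show "F (vert (h z)) = F (vert z)"
      by (rule F) (auto simp: h_def)
  qed (rule finite_flags)
qed

text \<open>
  The face opposite to the all-odd vertex may lie in a facet of the grid. Then there is no second simplex,
  but the block flip matches the facets \<open>x j = p\<close> and \<open>x j = - p\<close>, and the symmetry of \<open>F\<close> makes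
  their contributions cancel.
\<close>
lemma sum_flags_last_face:
  fixes F :: "(nat \<Rightarrow> nat \<Rightarrow> int) \<Rightarrow> bit"
  assumes "0 < N" "even p" "0 < p"
    and F: "\<And>v v'. (\<And>k. k < N \<Longrightarrow> v k = v' k) \<Longrightarrow> F v = F v'"
    and sym: "\<And>v j. (\<And>k. k < N \<Longrightarrow> v k \<in> grid N p \<and> \<bar>v k j\<bar> = p) \<Longrightarrow> j < N \<Longrightarrow>
       F (\<lambda>k. block_flip b (b j) (v k)) = F v"
  shows "(\<Sum>z\<in>flags N p. F (vert z)) = 0"
proof -
  define j :: "(nat \<Rightarrow> int) \<times> (nat \<Rightarrow> int) \<times> (nat \<Rightarrow> nat) \<Rightarrow> nat"
    where "j = (\<lambda>(a, c, r). inv r (N - 1))"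
  define h where "h = (\<lambda>(a::nat \<Rightarrow> int, c::nat \<Rightarrow> int, r::nat \<Rightarrow> nat).
    if \<bar>a (j (a, c, r))\<bar> = p
    then (block_flip b (b (j (a, c, r))) a, block_flip b (b (j (a, c, r))) c, r)
    else (a, \<lambda>i. if i = j (a, c, r) then 2 * a i - c i else c i, r))"
  show ?thesis
  proof (rule sum_bit_fixpoint_free_involution[where h = h])
    fix z assume z: "z \<in> flags N p"
    obtain a c r where [simp]: "z = (a, c, r)" by (cases z)
    have r: "r permutes {..<N}" using z by (simp add: flags_def)
    define i where "i = j z"
    have ri: "r i = N - 1" using permutes_inverses(1)[OF r] by (simp add: i_def j_def)
    have iN: "i < N" using ri assms(1) permutes_not_in[OF r, of i] by (cases "i < N") auto
    have ind: "j (a', c', r) = i" for a' c' by (simp add: i_def j_def)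
    have ai: "\<bar>a i\<bar> \<le> p" "even (a i)" "\<bar>c i - a i\<bar> = 1"
      using z iN by (auto simp: flags_def grid_def)
    have lt: "k < N" if "\<not> r i < k" "k \<le> N" for k :: nat
      using that ri assms(1) by linarith
    show "h z \<in> flags N p"
    proof (cases "\<bar>a i\<bar> = p")
      case True
      then show ?thesis
        using z by (auto simp: flags_def h_def grid_def ind block_flip_def)
    next
      case False
      have "\<bar>2 * a i - c i\<bar> \<le> p" using ai False by linarith
      then show ?thesis
        using z False iN ai by (auto simp: flags_def h_def grid_def ind)
    qed
    show "h (h z) = z"
      by (auto simp: h_def fun_eq_iff ind block_flip_def)
    show "h z \<noteq> z"
    proof (cases "\<bar>a i\<bar> = p")
      case True
      then have "block_flip b (b i) a i \<noteq> a i"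
        using assms(3) by (auto simp: block_flip_def)
      then show ?thesis
        using True by (auto simp: h_def fun_eq_iff ind)
    next
      case False
      then show ?thesis using ai
        by (auto simp: h_def fun_eq_iff ind intro!: exI[of _ i])
    qed
    show "F (vert (h z)) = F (vert z)"
    proof (cases "\<bar>a i\<bar> = p")
      case True
      have "F (\<lambda>k. block_flip b (b i) (vert z k)) = F (vert z)"
        using iN by (intro sym) (use vert_in_grid[OF z] True ri in auto)
      moreover have "vert (h z) = (\<lambda>k. block_flip b (b i) (vert z k))"
        using True by (auto simp: h_def ind block_flip_def fun_eq_iff)
      ultimately show ?thesis by simp
    next
      case False
      then show ?thesis using ri
        by (intro F) (auto simp: h_def ind fun_eq_iff)
    qed
  qed (rule finite_flags)
qed

text \<open>
  Discrete Stokes theorem. If the \<open>q\<close>-th entry is itself invariant under the boundary flips, the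
  integrand is the coboundary of the cochain in which the \<open>q\<close>-th factor is evaluated at a vertex instead of
  along an edge, and this cochain takes the same values on matched boundary faces.
\<close>
lemma sign_degree_invariant_entry:
  assumes N: "q < N" "even p" "0 < p"
    and s: "\<And>k j x. k < N \<Longrightarrow> k \<noteq> q \<Longrightarrow> j < N \<Longrightarrow> x \<in> grid N p \<Longrightarrow> \<bar>x j\<bar> = p \<Longrightarrow>
       s k (block_flip b (b j) x) = s k x + of_bool (b k = b j)"
    and u: "\<And>j x. j < N \<Longrightarrow> x \<in> grid N p \<Longrightarrow> \<bar>x j\<bar> = p \<Longrightarrow> s q (block_flip b (b j) x) = s q x"
  shows "sign_degree N p s = 0"
proof -
  \<comment> \<open>On the face that omits an inner vertex, the cochain has its factors before the gap in common with \<open>L\<close> and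
    those after the gap in common with \<open>R\<close>, and its factor across the gap is \<open>L i + R i\<close> by the cocycle
    property. So its face values are \<open>Z i + Z (Suc i)\<close> for \<open>i \<noteq> q\<close>, together with \<open>Z 0\<close> and
    \<open>Z N\<close>, while \<open>Z q + Z (Suc q)\<close> is the integrand.\<close>
  define L where "L v k = (if k < q then s k (v k) + s k (v (Suc k)) else if k = q then s q (v q)
      else s k (v (k - 1)) + s k (v k))" for v :: "nat \<Rightarrow> nat \<Rightarrow> int" and k
  define R where "R v k = (if k < q then s k (v (Suc k)) + s k (v (Suc (Suc k)))
      else if k = q then s q (v (Suc q)) else s k (v k) + s k (v (Suc k)))"
      for v :: "nat \<Rightarrow> nat \<Rightarrow> int" and k
  define Z where "Z i v = (\<Prod>k<N. if k < i then L v k else R v k)" for i v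
  define Zs where "Zs i = (\<Sum>z\<in>flags N p. Z i (vert z))" for i
  have step: "Z i v + Z (Suc i) v =
      (\<Prod>k<N. if k < i then L v k else if k = i then L v k + R v k else R v k)" if "i < N" for i v
  proof -
    have *: "(\<Prod>k<N. g k) = g i * (\<Prod>k\<in>{..<N} - {i}. g k)" for g :: "nat \<Rightarrow> bit"
      using that by (simp add: prod.remove)
    have 1: "(\<Prod>k\<in>{..<N} - {i}. if k < i then L v k else R v k) =
          (\<Prod>k\<in>{..<N} - {i}. if k < i then L v k else if k = i then L v k + R v k else R v k)"
         "(\<Prod>k\<in>{..<N} - {i}. if k < Suc i then L v k else R v k) =
          (\<Prod>k\<in>{..<N} - {i}. if k < i then L v k else if k = i then L v k + R v k else R v k)"
      by (rule prod.cong, auto)+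
    show ?thesis
      unfolding Z_def
      by (subst (1 2 3) *) (simp only: 1, simp add: algebra_simps)
  qed
  have const: "Zs i = Zs (Suc i)" if i: "i < N" "i \<noteq> q" for i
  proof -
    have "(\<Sum>z\<in>flags N p. Z i (vert z) + Z (Suc i) (vert z)) = 0"
    proof (cases "i < q")
      case True
      show ?thesis
      proof (rule sum_flags_inner_face[of i])
        show "Suc i < N" using True N by simp
        fix v v' :: "nat \<Rightarrow> nat \<Rightarrow> int" assume eq: "\<And>k. k \<noteq> Suc i \<Longrightarrow> v k = v' k"
        show "Z i v + Z (Suc i) v = Z i v' + Z (Suc i) v'"
          unfolding step[OF i(1)]
          using True by (intro prod.cong) (auto simp: L_def R_def eq algebra_simps)
      qed
    next
      case False
      then obtain i' where i': "i = Suc i'" using i(2) by (cases i) auto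
      show ?thesis
      proof (rule sum_flags_inner_face[of i'])
        show "Suc i' < N" using i' i by simp
        fix v v' :: "nat \<Rightarrow> nat \<Rightarrow> int" assume eq: "\<And>k. k \<noteq> Suc i' \<Longrightarrow> v k = v' k"
        show "Z i v + Z (Suc i) v = Z i v' + Z (Suc i) v'"
          unfolding step[OF i(1)]
          using False i(2) i' by (intro prod.cong) (auto simp: L_def R_def eq algebra_simps)
      qed
    qed
    then have "Zs i + Zs (Suc i) = 0" by (simp add: Zs_def sum.distrib)
    then show ?thesis by (cases "Zs i"; cases "Zs (Suc i)") auto
  qed
  have Z0: "Zs 0 = 0"
    unfolding Zs_def
  proof (rule sum_flags_first_face)
    fix v v' :: "nat \<Rightarrow> nat \<Rightarrow> int" assume eq: "\<And>k. k \<noteq> 0 \<Longrightarrow> v k = v' k"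
    show "Z 0 v = Z 0 v'" unfolding Z_def
      by (intro prod.cong) (auto simp: R_def eq)
  qed (use N in auto)
  have ZN: "Zs N = 0"
    unfolding Zs_def
  proof (rule sum_flags_last_face[where b = b])
    fix v v' :: "nat \<Rightarrow> nat \<Rightarrow> int" assume eq: "\<And>k. k < N \<Longrightarrow> v k = v' k"
    show "Z N v = Z N v'" unfolding Z_def
      using N by (intro prod.cong) (auto simp: L_def eq)
  next
    fix v :: "nat \<Rightarrow> nat \<Rightarrow> int" and j
    assume v: "\<And>k. k < N \<Longrightarrow> v k \<in> grid N p \<and> \<bar>v k j\<bar> = p" and j: "j < N"
    have "L (\<lambda>k. block_flip b (b j) (v k)) k = L v k" if "k < N" for k
    proof -
      have *: "s k (block_flip b (b j) (v k')) = s k (v k') + of_bool (b k = b j)"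
        if "k \<noteq> q" "k' < N" for k'
        using s[OF \<open>k < N\<close> that(1) j, of "v k'"] v[OF that(2)] by simp
      show ?thesis
        using that N u[OF j, of "v q"] v[of q] by (auto simp: L_def * algebra_simps)
    qed
    then show "Z N (\<lambda>k. block_flip b (b j) (v k)) = Z N v"
      unfolding Z_def by (intro prod.cong) auto
  qed (use N in auto)
  have low: "Zs i = 0" if "i \<le> q" for i
    using that
  proof (induction i)
    case (Suc i)
    then show ?case using const[of i] N by simp
  qed (simp add: Z0)
  have high: "Zs (N - i) = 0" if "i < N - q" for i
    using that
  proof (induction i)
    case (Suc i)
    then have "Zs (N - Suc i) = Zs (Suc (N - Suc i))" using const[of "N - Suc i"] by auto
    also have "Suc (N - Suc i) = N - i" using Suc by linarith
    finally show ?case using Suc by simp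
  qed (simp add: ZN)
  have "sign_degree N p s = (\<Sum>z\<in>flags N p. Z q (vert z) + Z (Suc q) (vert z))"
    unfolding sign_degree_def step[OF N(1)]
    by (intro sum.cong prod.cong) (auto simp: L_def R_def)
  also have "\<dots> = Zs q + Zs (Suc q)" by (simp add: Zs_def sum.distrib)
  also have "\<dots> = 0" using low[of q] high[of "N - Suc q"] N by (simp add: Suc_diff_Suc)
  finally show ?thesis .
qed

text \<open>
  The boundary condition satisfied by the restriction, to a product of hemispheres, of sign patterns on the
  product of spheres of which the \<open>k\<close>-th is odd in its own block and even in the others.
\<close>
definition twisted :: "nat \<Rightarrow> int \<Rightarrow> (nat \<Rightarrow> 'b) \<Rightarrow> (nat \<Rightarrow> (nat \<Rightarrow> int) \<Rightarrow> bit) \<Rightarrow> bool" where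
  "twisted N p b s \<longleftrightarrow> (\<forall>k<N. \<forall>j<N. \<forall>x\<in>grid N p. \<bar>x j\<bar> = p \<longrightarrow>
     s k (block_flip b (b j) x) = s k x + of_bool (b k = b j))"

lemma sign_degree_add:
  assumes "q < N"
  shows "sign_degree N p (s(q := \<lambda>x. f x + g x)) =
    sign_degree N p (s(q := f)) + sign_degree N p (s(q := g))"
proof -
  have *: "(\<Prod>k<N. h k) = h q * (\<Prod>k\<in>{..<N} - {q}. h k)" for h :: "nat \<Rightarrow> bit"
    using assms by (simp add: prod.remove)
  show ?thesis
    unfolding sign_degree_def sum.distrib[symmetric]
    by (subst (1 2 3) *) (simp add: algebra_simps cong: prod.cong_simp)
qed

text \<open>
  Exchange the entries one at a time. The degree is additive in each entry, and the difference of two twisted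
  entries satisfies an untwisted boundary condition.
\<close>
lemma sign_degree_eq_of_twisted:
  assumes "even p" "0 < p" "twisted N p b s" "twisted N p b s'"
  shows "sign_degree N p s = sign_degree N p s'"
proof -
  define t where "t q k = (if k < q then s' k else s k)" for q k
  have tw: "twisted N p b (t q)" for q
    using assms(3,4) by (auto simp: twisted_def t_def)
  have "sign_degree N p (t q) = sign_degree N p s" if "q \<le> N" for q
    using that
  proof (induction q)
    case 0
    show ?case by (simp add: t_def)
  next
    case (Suc q)
    define u where "u x = s q x + s' q x" for x
    have t1: "t (Suc q) = (t q)(q := \<lambda>x. s q x + u x)"
      by (auto simp: t_def u_def fun_eq_iff add.assoc[symmetric])
    have t0: "(t q)(q := s q) = t q" by (auto simp: t_def)
    have "sign_degree N p ((t q)(q := u)) = 0"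
    proof (rule sign_degree_invariant_entry[of q, where b = b])
      fix k j x assume *: "k < N" "k \<noteq> q" "j < N" "x \<in> grid N p" "\<bar>x j\<bar> = p"
      then show "((t q)(q := u)) k (block_flip b (b j) x) =
          ((t q)(q := u)) k x + of_bool (b k = b j)"
        using tw[of q] by (simp add: twisted_def)
    next
      fix j x assume *: "j < N" "x \<in> grid N p" "\<bar>x j\<bar> = p"
      then show "((t q)(q := u)) q (block_flip b (b j) x) = ((t q)(q := u)) q x"
        using assms(3,4) Suc.prems by (simp add: twisted_def u_def)
    qed (use assms Suc.prems in auto)
    then have "sign_degree N p (t (Suc q)) = sign_degree N p (t q)"
      using sign_degree_add[of q N p "t q" "s q" u] Suc.prems unfolding t1 t0 by (simp only: add_0_right Suc_le_eq)
    then show ?case using Suc by simp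
  qed
  from this[of N] have "sign_degree N p (t N) = sign_degree N p s" by simp
  moreover have "sign_degree N p (t N) = sign_degree N p s'"
    unfolding sign_degree_def by (intro sum.cong prod.cong) (auto simp: t_def)
  ultimately show ?thesis by simp
qed


text \<open>
  A reference pattern for which the degree can be counted by hand: whether the first facet of
  block \<open>l\<close> containing \<open>x\<close> is on the positive side, and 0 off all these facets.
\<close>
definition first_facet :: "nat \<Rightarrow> int \<Rightarrow> (nat \<Rightarrow> 'b) \<Rightarrow> 'b \<Rightarrow> (nat \<Rightarrow> int) \<Rightarrow> bit" where
  "first_facet N p b l x = (let J = {j. j < N \<and> b j = l \<and> \<bar>x j\<bar> = p} in
     of_bool (J \<noteq> {} \<and> x (Min J) = p))"

lemma first_facet_cong:
  assumes "\<And>j. j < N \<Longrightarrow> b j = l \<Longrightarrow> x j = y j \<or> (\<bar>x j\<bar> \<noteq> p \<and> \<bar>y j\<bar> \<noteq> p)"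
  shows "first_facet N p b l x = first_facet N p b l y"
proof -
  have J: "{j. j < N \<and> b j = l \<and> \<bar>x j\<bar> = p} = {j. j < N \<and> b j = l \<and> \<bar>y j\<bar> = p}"
    (is "?J = ?J'") using assms by metis
  have "x (Min ?J) = y (Min ?J)" if "?J \<noteq> {}"
  proof -
    have "Min ?J \<in> ?J" using that by (intro Min_in) auto
    then show ?thesis using assms by fastforce
  qed
  then show ?thesis
    unfolding first_facet_def Let_def J by (intro arg_cong[where f = of_bool] conj_cong refl) auto
qed

lemma first_facet_at:
  assumes "i < N" "b i = l" "\<bar>x i\<bar> = p"
    and "\<And>j. j < N \<Longrightarrow> b j = l \<Longrightarrow> \<bar>x j\<bar> = p \<Longrightarrow> i \<le> j"
  shows "first_facet N p b l x = of_bool (x i = p)"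
proof -
  have "Min {j. j < N \<and> b j = l \<and> \<bar>x j\<bar> = p} = i"
    using assms by (intro Min_eqI) auto
  then show ?thesis using assms by (auto simp: first_facet_def)
qed

lemma first_facet_none:
  assumes "\<And>j. j < N \<Longrightarrow> b j = l \<Longrightarrow> \<bar>x j\<bar> \<noteq> p"
  shows "first_facet N p b l x = 0"
  using assms by (auto simp: first_facet_def)

lemma first_facetE:
  fixes x :: "nat \<Rightarrow> int"
  assumes "k < N" "b k = l" "\<bar>x k\<bar> = p"
  obtains i where "i < N" "b i = l" "\<bar>x i\<bar> = p"
    "\<And>j. j < N \<Longrightarrow> b j = l \<Longrightarrow> \<bar>x j\<bar> = p \<Longrightarrow> i \<le> j" 
proof -
  let ?J = "{j. j < N \<and> b j = l \<and> \<bar>x j\<bar> = p}"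
  have "Min ?J \<in> ?J" using assms by (intro Min_in) auto
  then show ?thesis by (intro that[of "Min ?J"]) auto
qed

lemma twisted_first_facet:
  assumes "0 < p"
  shows "twisted N p b (\<lambda>k. first_facet N p b (b k))"
  unfolding twisted_def
proof (intro allI ballI impI)
  fix k j x
  assume k: "k < N" and j: "j < N" and x: "x \<in> grid N p" "\<bar>x j\<bar> = p"
  let ?y = "block_flip b (b j) x"
  show "first_facet N p b (b k) ?y = first_facet N p b (b k) x + of_bool (b k = b j)"
  proof (cases "b k = b j")
    case False
    then show ?thesis
      by (simp, intro first_facet_cong) (auto simp: block_flip_def)
  next
    case True
    obtain i where i: "i < N" "b i = b j" "\<bar>x i\<bar> = p"
      "\<And>j'. j' < N \<Longrightarrow> b j' = b j \<Longrightarrow> \<bar>x j'\<bar> = p \<Longrightarrow> i \<le> j'"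
      using first_facetE[of j N b "b j" x p] j x(2) by metis
    have "first_facet N p b (b j) x = of_bool (x i = p)"
      using i by (intro first_facet_at) auto
    moreover have "first_facet N p b (b j) ?y = of_bool (?y i = p)"
      using i by (intro first_facet_at) (auto simp: block_flip_def split: if_splits)
    ultimately show ?thesis
      using True i assms by (auto simp: block_flip_def)
  qed
qed

lemma permutes_id_if_increasing_on_blocks:
  fixes r :: "nat \<Rightarrow> nat"
  assumes r: "r permutes {..<N}"
    and b: "\<And>i. i < N \<Longrightarrow> b (r i) = b i"
    and inc: "\<And>i j. i < j \<Longrightarrow> j < N \<Longrightarrow> b i = b j \<Longrightarrow> r i < r j"
  shows "r = id"
proof -
  have "r i = i" if "i < N" for i
    using that
  proof (induction i rule: less_induct)
    case (less i)
    obtain i' where i': "r i' = i" using r by (metis permutes_surj surjD)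
    have "i' < N" using i' less.prems permutes_not_in[OF r, of i'] by (cases "i' < N") auto
    have "\<not> i' < i" using less.IH[of i'] i' \<open>i' < N\<close> by auto
    moreover have "\<not> i < i'"
    proof
      assume "i < i'"
      have "r i < i" using inc[OF \<open>i < i'\<close> \<open>i' < N\<close>] b[OF \<open>i' < N\<close>] i' by simp
      then have "r (r i) = r i" using less by auto
      then have "r i = i" using permutes_inj[OF r] by (meson injD)
      then show False using \<open>r i < i\<close> by simp
    qed
    ultimately show ?case using i' by (metis nat_neq_iff)
  qed
  moreover have "r i = i" if "\<not> i < N" for i using permutes_not_in[OF r, of i] that by simp
  ultimately show ?thesis by (metis eq_id_iff)
qed

definition next_in_block :: "nat \<Rightarrow> (nat \<Rightarrow> 'b) \<Rightarrow> nat \<Rightarrow> nat \<Rightarrow> bool" where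
  "next_in_block N b i j \<longleftrightarrow> i < j \<and> j < N \<and> b j = b i \<and> (\<forall>i'. i < i' \<and> i' < j \<longrightarrow> b i' \<noteq> b i)"

definition last_in_block :: "nat \<Rightarrow> (nat \<Rightarrow> 'b) \<Rightarrow> nat \<Rightarrow> bool" where
  "last_in_block N b i \<longleftrightarrow> (\<forall>j. i < j \<and> j < N \<longrightarrow> b j \<noteq> b i)"

lemma next_in_blockE:
  assumes "\<not> last_in_block N b i"
  obtains j where "next_in_block N b i j"
proof -
  let ?P = "\<lambda>j. i < j \<and> j < N \<and> b j = b i"
  obtain j where "?P j" using assms by (auto simp: last_in_block_def)
  then have "?P (LEAST j. ?P j)" by (rule LeastI)
  moreover have "\<not> ?P i'" if "i' < (LEAST j. ?P j)" for i' using that by (rule not_less_Least)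
  ultimately have "next_in_block N b i (LEAST j. ?P j)"
    unfolding next_in_block_def by (meson less_trans)
  then show ?thesis by (rule that)
qed

lemma vert_facets:
  assumes z: "(a, c, r) \<in> flags N p" "even p" and j: "j < N"
  shows "\<bar>vert (a, c, r) k j\<bar> = p \<longleftrightarrow> k \<le> r j \<and> \<bar>a j\<bar> = p"
    and "k \<le> r j \<Longrightarrow> vert (a, c, r) k j = a j"
  using flags_odd_interior(1)[OF z j] by (cases "r j < k"; simp)+

text \<open>
  Step \<open>r j\<close> changes only coordinate \<open>j\<close>, moving it off the boundary. It can change the sign
  belonging to that step only if \<open>j\<close> lies in the right block, sits on a facet, and is the first coordinate of
  its block that still does. Hence the steps inside each block occur in increasing order, and \<open>r\<close> is the
  identity.
\<close>
lemma sign_change_flag_structure: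
  assumes z: "(a, c, r) \<in> flags N p" "even p" "0 < p"
    and change: "\<And>k. k < N \<Longrightarrow>
      first_facet N p b (b k) (vert (a, c, r) k) \<noteq> first_facet N p b (b k) (vert (a, c, r) (Suc k))"
  shows "r = id" and "\<And>j. j < N \<Longrightarrow> \<bar>a j\<bar> = p"
proof -
  let ?v = "vert (a, c, r)"
  have r: "r permutes {..<N}" using z by (simp add: flags_def)
  have rN: "r j < N" if "j < N" for j using permutes_in_image[OF r, of j] that by simp
  have key: "b (r j) = b j \<and> \<bar>a j\<bar> = p \<and>
      (\<forall>i<N. b i = b j \<and> \<bar>a i\<bar> = p \<and> r j \<le> r i \<longrightarrow> j \<le> i)" if j: "j < N" for j
  proof -
    have eq: "?v (r j) i = ?v (Suc (r j)) i" if "i \<noteq> j" for i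
    proof -
      have "r i \<noteq> r j" using that permutes_inj[OF r] by (meson injD)
      then show ?thesis by auto
    qed
    note ch = change[OF rN[OF j]]
    have 1: "b j = b (r j)" "\<bar>a j\<bar> = p"
    proof -
      have "b j = b (r j) \<and> \<bar>a j\<bar> = p"
      proof (rule ccontr)
        assume *: "\<not> ?thesis"
        have "first_facet N p b (b (r j)) (?v (r j)) = first_facet N p b (b (r j)) (?v (Suc (r j)))"
        proof (rule first_facet_cong)
          fix i assume "i < N" "b i = b (r j)"
          then show "?v (r j) i = ?v (Suc (r j)) i \<or> \<bar>?v (r j) i\<bar> \<noteq> p \<and> \<bar>?v (Suc (r j)) i\<bar> \<noteq> p"
            using * eq[of i] flags_odd_interior(1)[OF z(1,2) j] by (cases "i = j") auto
        qed
        then show False using ch by simp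
      qed
      then show "b j = b (r j)" "\<bar>a j\<bar> = p" by auto
    qed
    have "j \<le> i" if i: "i < N" "b i = b j" "\<bar>a i\<bar> = p" "r j \<le> r i" for i
    proof (rule ccontr)
      assume "\<not> j \<le> i"
      have "\<bar>?v (r j) i\<bar> = p" using vert_facets(1)[OF z(1,2) i(1)] i by simp
      then obtain m where m: "m < N" "b m = b j" "\<bar>?v (r j) m\<bar> = p"
        "\<And>i'. i' < N \<Longrightarrow> b i' = b j \<Longrightarrow> \<bar>?v (r j) i'\<bar> = p \<Longrightarrow> m \<le> i'"
        using first_facetE[of i N b "b j" "?v (r j)" p] i(1,2) by blast
      have "m \<le> i" using m(4)[OF i(1,2)] \<open>\<bar>?v (r j) i\<bar> = p\<close> by simp
      then have mj: "m \<noteq> j" using \<open>\<not> j \<le> i\<close> by simp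
      have "first_facet N p b (b j) (?v (r j)) = of_bool (?v (r j) m = p)"
        by (rule first_facet_at) (use m in auto)
      moreover have "first_facet N p b (b j) (?v (Suc (r j))) = of_bool (?v (Suc (r j)) m = p)"
      proof (rule first_facet_at)
        show "\<bar>?v (Suc (r j)) m\<bar> = p" using m(3) eq[OF mj] by simp
        fix i' assume "i' < N" "b i' = b j" "\<bar>?v (Suc (r j)) i'\<bar> = p"
        then show "m \<le> i'"
          using m(4)[of i'] vert_facets(1)[OF z(1,2), of i'] by auto
      qed (use m in auto)
      ultimately show False using ch 1 eq[OF mj] by simp
    qed
    then show ?thesis using 1 by auto
  qed
  then show "\<And>j. j < N \<Longrightarrow> \<bar>a j\<bar> = p" by blast
  show "r = id"
  proof (rule permutes_id_if_increasing_on_blocks[OF r])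
    show "b (r i) = b i" if "i < N" for i using key that by blast
    show "r i < r j" if "i < j" "j < N" "b i = b j" for i j
      using key[of i] key[of j] that by (meson leD less_trans not_le_imp_less)
  qed
qed

lemma sign_change_id_flag_iff:
  assumes z: "(a, c, id) \<in> flags N p" "even p" "0 < p" and a: "\<And>j. j < N \<Longrightarrow> \<bar>a j\<bar> = p"
    and k: "k < N"
  shows "first_facet N p b (b k) (vert (a, c, id) k) \<noteq> first_facet N p b (b k) (vert (a, c, id) (Suc k))
    \<longleftrightarrow> (last_in_block N b k \<longrightarrow> a k = p) \<and> (\<forall>j. next_in_block N b k j \<longrightarrow> a j = - a k)"
proof -
  let ?v = "vert (a, c, id)"
  note vf = vert_facets[OF z(1,2)]
  have k0: "first_facet N p b (b k) (?v k) = of_bool (a k = p)"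
    using first_facet_at[of k N b "b k" "?v k" p] vf a k by simp
  show ?thesis
  proof (cases "last_in_block N b k")
    case True
    have "first_facet N p b (b k) (?v (Suc k)) = 0"
    proof (rule first_facet_none)
      fix j assume "j < N" "b j = b k"
      then show "\<bar>?v (Suc k) j\<bar> \<noteq> p"
        using True vf(1)[of j "Suc k"] by (auto simp: last_in_block_def)
    qed
    moreover have "\<not> next_in_block N b k j" for j
      using True by (auto simp: next_in_block_def last_in_block_def)
    ultimately show ?thesis using True k0 by auto
  next
    case False
    then obtain j where j: "next_in_block N b k j" by (rule next_in_blockE)
    then have jN: "k < j" "j < N" "b j = b k" by (auto simp: next_in_block_def)
    have uniq: "j' = j" if "next_in_block N b k j'" for j'
      using that j by (auto simp: next_in_block_def) (metis nat_neq_iff)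
    have "first_facet N p b (b k) (?v (Suc k)) = of_bool (?v (Suc k) j = p)"
    proof (rule first_facet_at)
      show "\<bar>?v (Suc k) j\<bar> = p" using vf(1)[of j "Suc k"] jN a by simp
      fix i assume i: "i < N" "b i = b k" "\<bar>?v (Suc k) i\<bar> = p"
      then have "k < i" using vf(1)[of i "Suc k"] by simp
      then show "j \<le> i" using i j unfolding next_in_block_def by (meson not_le)
    qed (use jN in auto)
    also have "?v (Suc k) j = a j" using jN by simp
    finally have k1: "first_facet N p b (b k) (?v (Suc k)) = of_bool (a j = p)" .
    have "a k = p \<or> a k = - p" "a j = p \<or> a j = - p"
      using a[OF k] a[OF jN(2)] by linarith+
    then have "(of_bool (a k = p) :: bit) \<noteq> of_bool (a j = p) \<longleftrightarrow> a j = - a k"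
      using z(3) by (elim disjE) simp_all
    moreover have "(\<forall>j'. next_in_block N b k j' \<longrightarrow> a j' = - a k) \<longleftrightarrow> a j = - a k"
      using j uniq by blast
    ultimately show ?thesis
      using False unfolding k0 k1 by blast
  qed
qed

definition alternating_corner :: "nat \<Rightarrow> int \<Rightarrow> (nat \<Rightarrow> 'b) \<Rightarrow> nat \<Rightarrow> int" where
  "alternating_corner N p b j = (if j < N then p * (-1) ^ card {i. j < i \<and> i < N \<and> b i = b j} else 0)"

lemma alternating_corner_last: "k < N \<Longrightarrow> last_in_block N b k \<Longrightarrow> alternating_corner N p b k = p"
proof -
  assume "k < N" "last_in_block N b k"
  moreover from this have "{i. k < i \<and> i < N \<and> b i = b k} = {}"
    by (auto simp: last_in_block_def)
  ultimately show ?thesis unfolding alternating_corner_def by (simp only: if_True card.empty power_0 mult_1_right)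
qed

lemma alternating_corner_next:
  assumes "next_in_block N b k j"
  shows "alternating_corner N p b j = - alternating_corner N p b k"
proof -
  have "{i. k < i \<and> i < N \<and> b i = b k} = insert j {i. j < i \<and> i < N \<and> b i = b j}"
    using assms by (auto simp: next_in_block_def)
  then show ?thesis
    using assms by (auto simp: alternating_corner_def next_in_block_def)
qed

text \<open>
  The sign change at step \<open>k\<close> forces the next coordinate of the block to lie on the opposite side, and
  the last one to lie on the side \<open>p\<close>; so the starting corner is determined from the end of each block.
\<close>
lemma alternating_corner_unique:
  assumes "\<And>k. k < N \<Longrightarrow> last_in_block N b k \<Longrightarrow> a k = p"
    and "\<And>k j. k < N \<Longrightarrow> next_in_block N b k j \<Longrightarrow> a j = - a k" and "k < N"
  shows "a k = alternating_corner N p b k"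
  using assms(3)
proof (induction "N - k" arbitrary: k rule: less_induct)
  case less
  show ?case
  proof (cases "last_in_block N b k")
    case True
    then show ?thesis using less assms(1) alternating_corner_last by metis
  next
    case False
    then obtain j where j: "next_in_block N b k j" by (rule next_in_blockE)
    have "a j = alternating_corner N p b j"
      using less j by (intro less.hyps) (auto simp: next_in_block_def)
    then show ?thesis using assms(2)[OF less.prems j] alternating_corner_next[OF j, of p] by simp
  qed
qed

lemma sign_degree_first_facet:
  assumes p: "even p" "0 < p"
  shows "sign_degree N p (\<lambda>k. first_facet N p b (b k)) = 1"
proof -
  define a where "a = alternating_corner N p b"
  define c where "c j = a j - sgn (a j)" for j
  have absa: "\<bar>a j\<bar> = p" if "j < N" for j
    using that p by (auto simp: a_def alternating_corner_def abs_mult power_abs)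
  have a0: "a j = 0" if "\<not> j < N" for j
    using that by (simp add: a_def alternating_corner_def)
  have sg: "sgn (a j) = 1 \<and> a j = p \<or> sgn (a j) = - 1 \<and> a j = - p" if "j < N" for j
    using absa[OF that] p by (cases "0 < a j") (auto simp: sgn_if abs_if split: if_splits)
  have mem: "(a, c, id) \<in> flags N p"
  proof -
    have "\<bar>a j\<bar> \<le> p \<and> \<bar>c j\<bar> \<le> p \<and> even (a j) \<and> odd (c j) \<and> \<bar>c j - a j\<bar> = 1" if "j < N" for j
      using sg[OF that] p by (auto simp: c_def)
    moreover have "a j = 0 \<and> c j = 0" if "\<not> j < N" for j
      using a0[OF that] by (simp add: c_def)
    ultimately show ?thesis
      unfolding flags_def grid_def by (simp add: permutes_id)
  qed
  let ?s = "\<lambda>k. first_facet N p b (b k)"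
  let ?P = "\<lambda>z. \<Prod>k<N. ?s k (vert z k) + ?s k (vert z (Suc k))"
  have P: "?P z = of_bool (\<forall>k<N. ?s k (vert z k) \<noteq> ?s k (vert z (Suc k)))" for z
  proof -
    have "x + y = of_bool (x \<noteq> y)" for x y :: bit by (cases x; cases y) auto
    then have "?P z = (\<Prod>k<N. of_bool (?s k (vert z k) \<noteq> ?s k (vert z (Suc k))))"
      by (intro prod.cong) auto
    also have "\<dots> = of_bool (\<forall>k<N. ?s k (vert z k) \<noteq> ?s k (vert z (Suc k)))"
      by (induction N) (auto simp: less_Suc_eq)
    finally show ?thesis .
  qed
  have iff: "(\<forall>k<N. ?s k (vert z k) \<noteq> ?s k (vert z (Suc k))) \<longleftrightarrow> z = (a, c, id)"
    if z: "z \<in> flags N p" for z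
  proof
    assume "z = (a, c, id)"
    then show "\<forall>k<N. ?s k (vert z k) \<noteq> ?s k (vert z (Suc k))"
      using sign_change_id_flag_iff[OF mem p absa, of _ b]
      by (auto simp: a_def alternating_corner_last alternating_corner_next)
  next
    assume ch: "\<forall>k<N. ?s k (vert z k) \<noteq> ?s k (vert z (Suc k))"
    obtain a' c' r where zz: "z = (a', c', r)" by (cases z)
    note z' = z[unfolded zz]
    note st = sign_change_flag_structure[OF z' p, of b]
    have r: "r = id" using st(1) ch zz by blast
    have abs': "\<bar>a' j\<bar> = p" if "j < N" for j using st(2) ch zz that by blast
    note iff' = sign_change_id_flag_iff[OF z'[unfolded r] p abs', of _ b]
    have cond: "(last_in_block N b k \<longrightarrow> a' k = p) \<and> (\<forall>j. next_in_block N b k j \<longrightarrow> a' j = - a' k)"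
      if "k < N" for k
      using iff'[OF _ that] ch that unfolding zz r by simp
    have "a' k = a k" if "k < N" for k
      unfolding a_def by (rule alternating_corner_unique[OF _ _ that]) (use cond in simp_all)
    moreover have out: "a' k = 0" "c' k = 0" if "\<not> k < N" for k
      using z' that by (auto simp: flags_def grid_def)
    ultimately have aa: "a' = a" using a0 by (metis ext)
    have "c' j = c j" for j
    proof (cases "j < N")
      case True
      have "\<bar>c' j\<bar> < p" using flags_odd_interior(2)[OF z' p(1) True] .
      moreover have "\<bar>c' j - a j\<bar> = 1" using z' True aa by (auto simp: flags_def)
      ultimately show ?thesis using sg[OF True] by (auto simp: c_def)
    next
      case False
      then show ?thesis using out a0 by (simp add: c_def)
    qed
    then show "z = (a, c, id)" using zz r aa by auto
  qed
  have "sign_degree N p ?s = (\<Sum>z\<in>flags N p. if z = (a, c, id) then 1 else 0)"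
    unfolding sign_degree_def by (intro sum.cong refl) (simp only: P iff of_bool_def)
  also have "\<dots> = 1" using mem by (simp add: finite_flags)
  finally show ?thesis .
qed

lemma exists_sign_changing_flag:
  assumes p: "even p" "0 < p" and s: "twisted N p b s"
  obtains z where "z \<in> flags N p" "\<And>k. k < N \<Longrightarrow> s k (vert z k) \<noteq> s k (vert z (Suc k))"
proof -
  have "sign_degree N p s = 1"
    using sign_degree_eq_of_twisted[OF p s twisted_first_facet] p sign_degree_first_facet[OF p, of N b]
    by simp
  then have "(\<Sum>z\<in>flags N p. \<Prod>k<N. s k (vert z k) + s k (vert z (Suc k))) \<noteq> 0"
    by (simp add: sign_degree_def)
  then obtain z where "z \<in> flags N p" "(\<Prod>k<N. s k (vert z k) + s k (vert z (Suc k))) \<noteq> 0"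
    by (rule sum.not_neutral_contains_not_neutral)
  note z = this
  show ?thesis
  proof (rule that[OF z(1)])
    fix k assume "k < N"
    then have "s k (vert z k) + s k (vert z (Suc k)) \<noteq> 0"
      using z(2) by (auto simp del: bit_not_zero_iff simp: prod_zero_iff)
    then show "s k (vert z k) \<noteq> s k (vert z (Suc k))" by auto
  qed
qed

section \<open>Borsuk--Ulam for products of spheres\<close>

text \<open>
  The block coordinates of a point of the cube parametrise a closed hemisphere, whose equator is where
  some coordinate of the block is \<open>1\<close> or \<open>-1\<close>. The cube sits in \<^typ>\<open>nat \<Rightarrow> real\<close> so that its dimension can be any number.
\<close>
definition cube :: "nat \<Rightarrow> (nat \<Rightarrow> real) set" where
  "cube N = {x. (\<forall>j<N. \<bar>x j\<bar> \<le> 1) \<and> (\<forall>j\<ge>N. x j = 0)}"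

lemma compact_cube: "compact (cube N)"
proof -
  have "compactin (product_topology (\<lambda>_. euclidean) UNIV) (\<Pi>\<^sub>E j\<in>UNIV. if j < N then {-1..1} else {0::real})"
    by (auto simp: compactin_PiE)
  moreover have "(\<Pi>\<^sub>E j\<in>UNIV. if j < N then {-1..1} else {0::real}) = cube N"
  proof -
    have "(\<forall>j. x j \<in> (if j < N then {-1..1} else {0})) \<longleftrightarrow>
        (\<forall>j<N. x j \<in> {-1..1}) \<and> (\<forall>j\<ge>N. x j \<in> {0})" for x :: "nat \<Rightarrow> real"
      by (metis not_less)
    then show ?thesis by (auto simp: cube_def PiE_UNIV_domain Pi_def abs_le_iff minus_le_iff)
  qed
  ultimately show ?thesis by (simp add: euclidean_product_topology)
qed

lemma tendsto_coordinatewise: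
  fixes f :: "'c \<Rightarrow> 'a \<Rightarrow> 'b::topological_space"
  assumes "\<And>j. ((\<lambda>i. f i j) \<longlongrightarrow> l j) F"
  shows "(f \<longlongrightarrow> l) F"
proof -
  have "limitin (product_topology (\<lambda>_. euclidean) UNIV) f l F"
    using assms by (simp add: limitin_componentwise)
  then show ?thesis by (simp add: euclidean_product_topology)
qed

text \<open>
  Sample the signs of \<open>G\<close> on ever finer grids. Each grid has a simplex whose \<open>k\<close>-th edge changes the sign of
  \<open>G k\<close> for every \<open>k\<close>; the simplices shrink, and at a limit point of them all \<open>G k\<close> vanish.
\<close>
lemma block_Borsuk_Ulam:
  fixes G :: "nat \<Rightarrow> (nat \<Rightarrow> real) \<Rightarrow> real"
  assumes cont: "\<And>k. k < N \<Longrightarrow> continuous_on (cube N) (G k)"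
    and sym: "\<And>k j x. k < N \<Longrightarrow> j < N \<Longrightarrow> x \<in> cube N \<Longrightarrow> \<bar>x j\<bar> = 1 \<Longrightarrow>
      G k (block_flip b (b j) x) = (if b k = b j then - G k x else G k x)"
  shows "\<exists>x\<in>cube N. \<forall>k<N. G k x = 0"
proof -
  define p where "p i = 2 * int (Suc i)" for i
  define sc where "sc i x = (\<lambda>j. real_of_int (x j) / real_of_int (p i))" for i and x :: "nat \<Rightarrow> int"
  \<comment> \<open>Where \<open>G k\<close> is zero the sign must still be odd on the boundary, so the reference pattern breaks the tie.\<close>
  define s where "s i k x = (of_bool (if G k (sc i x) = 0 then first_facet N (p i) b (b k) x = 1
      else G k (sc i x) > 0) :: bit)" for i k x
  have p: "even (p i)" "0 < p i" for i by (auto simp: p_def)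
  have sc_cube: "sc i x \<in> cube N" if "x \<in> grid N (p i)" for i x
    using that p(2)[of i] by (auto simp: cube_def grid_def sc_def abs_le_iff field_simps)
  have "twisted N (p i) b (s i)" for i
    unfolding twisted_def
  proof (intro allI ballI impI)
    fix k j x assume k: "k < N" and j: "j < N" and x: "x \<in> grid N (p i)" "\<bar>x j\<bar> = p i"
    have flip: "sc i (block_flip b (b j) x) = block_flip b (b j) (sc i x)"
      by (auto simp: sc_def block_flip_def)
    have "\<bar>sc i x j\<bar> = 1" using x(2) p(2)[of i] by (auto simp: sc_def)
    then have G: "G k (sc i (block_flip b (b j) x)) =
        (if b k = b j then - G k (sc i x) else G k (sc i x))"
      using sym[OF k j sc_cube[OF x(1)]] by (simp add: flip)
    have f: "first_facet N (p i) b (b k) (block_flip b (b j) x) =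
        first_facet N (p i) b (b k) x + of_bool (b k = b j)"
      using twisted_first_facet[OF p(2), of N i b] k j x by (simp add: twisted_def)
    show "s i k (block_flip b (b j) x) = s i k x + of_bool (b k = b j)"
      unfolding s_def G f
      by (cases "first_facet N (p i) b (b k) x") auto
  qed
  then have "\<exists>z\<in>flags N (p i). \<forall>k<N. s i k (vert z k) \<noteq> s i k (vert z (Suc k))" for i
    using exists_sign_changing_flag[OF p] by metis
  then obtain z where z: "\<And>i. z i \<in> flags N (p i)"
    "\<And>i k. k < N \<Longrightarrow> s i k (vert (z i) k) \<noteq> s i k (vert (z i) (Suc k))"
    by metis
  define X where "X k i = sc i (vert (z i) k)" for k i
  have Xc: "X k i \<in> cube N" for k i
    unfolding X_def by (intro sc_cube vert_in_grid z)
  have prod: "G k (X k i) * G k (X (Suc k) i) \<le> 0" if "k < N" for k i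
    using z(2)[OF that, of i] unfolding s_def X_def
    by (auto simp: mult_le_0_iff split: if_splits)
  obtain l \<rho> where l: "l \<in> cube N" and \<rho>: "strict_mono \<rho>" and lim: "(X 0 \<circ> \<rho>) \<longlonglongrightarrow> l"
    using compact_cube[of N] Xc unfolding compact_eq_seq_compact_metric seq_compact_def by metis
  have close: "\<bar>X k i j - X 0 i j\<bar> \<le> 1 / real (Suc i)" for k i j
  proof -
    obtain a c r where zi: "z i = (a, c, r)" by (cases "z i")
    have "\<bar>c j - a j\<bar> \<le> 1"
      using z(1)[of i] unfolding zi by (cases "j < N") (auto simp: flags_def grid_def)
    then have "\<bar>vert (z i) k j - vert (z i) 0 j\<bar> \<le> 1" by (simp add: zi)
    then have "\<bar>real_of_int (vert (z i) k j) - real_of_int (vert (z i) 0 j)\<bar> \<le> 1" by linarith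
    then have "\<bar>X k i j - X 0 i j\<bar> \<le> 1 / real_of_int (p i)"
      using p(2)[of i] by (simp add: X_def sc_def divide_right_mono flip: diff_divide_distrib)
    also have "\<dots> \<le> 1 / real (Suc i)" by (intro divide_left_mono) (auto simp: p_def)
    finally show ?thesis .
  qed
  have limk: "(X k \<circ> \<rho>) \<longlonglongrightarrow> l" for k
  proof (rule tendsto_coordinatewise)
    fix j
    have "(\<lambda>i. X k i j - X 0 i j) \<longlonglongrightarrow> 0"
    proof (rule Lim_null_comparison)
      show "\<forall>\<^sub>F i in sequentially. norm (X k i j - X 0 i j) \<le> 1 / real (Suc i)"
        using close by simp
      show "(\<lambda>i. 1 / real (Suc i)) \<longlonglongrightarrow> 0" by (rule LIMSEQ_Suc[OF lim_1_over_n])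
    qed
    then have "(\<lambda>i. X k (\<rho> i) j - X 0 (\<rho> i) j) \<longlonglongrightarrow> 0"
      using LIMSEQ_subseq_LIMSEQ[OF _ \<rho>] by (fastforce simp: o_def)
    moreover have "(\<lambda>i. X 0 (\<rho> i) j) \<longlonglongrightarrow> l j"
      using continuous_on_tendsto_compose[OF continuous_on_product_coordinates[of j] lim]
      by (simp add: o_def)
    ultimately show "(\<lambda>i. (X k \<circ> \<rho>) i j) \<longlonglongrightarrow> l j"
      using tendsto_add by fastforce
  qed
  have "G k l = 0" if k: "k < N" for k
  proof -
    have G: "(\<lambda>i. G k (X k' (\<rho> i))) \<longlonglongrightarrow> G k l" for k'
      using continuous_on_tendsto_compose[OF cont[OF k] limk[of k'] l] Xc by (simp add: o_def)
    have "G k l * G k l \<le> 0"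
      by (rule LIMSEQ_le_const2[OF tendsto_mult[OF G[of k] G[of "Suc k"]]])
         (use prod[OF k] in auto)
    then show ?thesis by (metis mult_eq_0_iff mult_le_0_iff nle_le)
  qed
  with l show ?thesis by blast
qed

section \<open>Thickening a cover and separating its levels\<close>

lemma compact_pos_bound:
  fixes h :: "'b::topological_space \<Rightarrow> real"
  assumes "compact Z" "continuous_on Z h" "\<And>x. x \<in> Z \<Longrightarrow> 0 < h x"
  shows "\<forall>\<^sub>F \<epsilon> in at_right 0. \<forall>x\<in>Z. \<epsilon> < h x"
proof (cases "Z = {}")
  case False
  then obtain x where x: "x \<in> Z" "\<And>y. y \<in> Z \<Longrightarrow> h x \<le> h y"
    using continuous_attains_inf[OF assms(1) False assms(2)] by blast
  show ?thesis
    using eventually_at_right_real[OF assms(3)[OF x(1)]]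
    by eventually_elim (use x(2) in force)
qed simp

text \<open>
  The sum of the distances to \<open>n + 1\<close> of the sets has no zero on \<open>K\<close>, hence a positive lower bound there; a
  point close to all of these sets would violate it.
\<close>
lemma eventually_thickening_multiplicity:
  fixes C :: "'i \<Rightarrow> 'b::metric_space set"
  assumes "compact K" "finite I" "\<And>i. i \<in> I \<Longrightarrow> closed (C i)" "\<And>i. i \<in> I \<Longrightarrow> C i \<noteq> {}"
    and mult: "\<And>x. x \<in> K \<Longrightarrow> card {i \<in> I. x \<in> C i} \<le> n"
  shows "\<forall>\<^sub>F \<epsilon> in at_right 0. \<forall>x\<in>K. card {i \<in> I. infdist x (C i) < \<epsilon>} \<le> n"
proof -
  define \<J> where "\<J> = {J. J \<subseteq> I \<and> card J = Suc n}"
  have fin: "finite \<J>" unfolding \<J>_def using assms(2) by simp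
  have "\<forall>\<^sub>F \<epsilon> in at_right 0. \<forall>x\<in>K. \<epsilon> < (\<Sum>i\<in>J. infdist x (C i)) / real (Suc n)" if J: "J \<in> \<J>" for J
  proof (rule compact_pos_bound[OF assms(1)])
    show "continuous_on K (\<lambda>x. (\<Sum>i\<in>J. infdist x (C i)) / real (Suc n))"
      by (intro continuous_intros) auto
    fix x assume x: "x \<in> K"
    have JI: "J \<subseteq> I" "card J = Suc n" using J by (auto simp: \<J>_def)
    then have "finite J" using assms(2) finite_subset by blast
    have "\<not> J \<subseteq> {i \<in> I. x \<in> C i}"
      using card_mono[of "{i \<in> I. x \<in> C i}" J] assms(2) mult[OF x] JI by auto
    then obtain i where i: "i \<in> J" "x \<notin> C i" using JI by auto
    then have "0 < infdist x (C i)" using JI assms(3,4) by (intro infdist_pos_not_in_closed) auto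
    also have "\<dots> \<le> (\<Sum>i\<in>J. infdist x (C i))"
      by (rule member_le_sum) (use i \<open>finite J\<close> in \<open>auto simp: infdist_nonneg\<close>)
    finally show "0 < (\<Sum>i\<in>J. infdist x (C i)) / real (Suc n)" by simp
  qed
  then have "\<forall>\<^sub>F \<epsilon> in at_right 0. \<forall>J\<in>\<J>. \<forall>x\<in>K. \<epsilon> < (\<Sum>i\<in>J. infdist x (C i)) / real (Suc n)"
    using fin by (intro eventually_ball_finite) auto
  then show ?thesis
  proof (rule eventually_mono)
    fix \<epsilon>
    assume elim: "\<forall>J\<in>\<J>. \<forall>x\<in>K. \<epsilon> < (\<Sum>i\<in>J. infdist x (C i)) / real (Suc n)"
    show "\<forall>x\<in>K. card {i \<in> I. infdist x (C i) < \<epsilon>} \<le> n"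
    proof
      fix x assume x: "x \<in> K"
      show "card {i \<in> I. infdist x (C i) < \<epsilon>} \<le> n"
      proof (rule ccontr)
        assume "\<not> ?thesis"
        then have "Suc n \<le> card {i \<in> I. infdist x (C i) < \<epsilon>}" by simp
        then obtain J where J: "J \<subseteq> {i \<in> I. infdist x (C i) < \<epsilon>}" "card J = Suc n"
          by (rule obtain_subset_with_card_n)
        have "(\<Sum>i\<in>J. infdist x (C i)) \<le> (\<Sum>i\<in>J. \<epsilon>)"
          by (rule sum_mono) (use J in auto)
        also have "\<dots> = real (Suc n) * \<epsilon>" using J by simp
        finally have "(\<Sum>i\<in>J. infdist x (C i)) / real (Suc n) \<le> \<epsilon>"
          by (simp add: divide_simps mult.commute)
        moreover have "J \<in> \<J>" using J by (auto simp: \<J>_def)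
        ultimately show False using elim x by (metis not_le)
      qed
    qed
  qed
qed

text \<open>
  For nonnegative \<open>\<phi>\<close> on a finite \<open>I\<close>, nonzero exactly when \<open>\<phi>\<close> is positive on \<open>J\<close> and takes
  smaller values on \<open>I - J\<close> than on \<open>J\<close>. Products of positive parts make it continuous in the values of \<open>\<phi>\<close>.
\<close>
definition top_weight :: "('i \<Rightarrow> real) \<Rightarrow> 'i set \<Rightarrow> 'i set \<Rightarrow> real" where
  "top_weight \<phi> I J = (\<Prod>i\<in>J. \<phi> i * (\<Prod>i'\<in>I - J. max 0 (\<phi> i - \<phi> i')))"

lemma top_weight_factor:
  assumes "finite I" "J \<subseteq> I" "top_weight \<phi> I J \<noteq> 0" "i \<in> J"
  shows "\<phi> i \<noteq> 0" and "\<And>i'. i' \<in> I - J \<Longrightarrow> \<phi> i' < \<phi> i"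
proof -
  have "finite J" using assms finite_subset by blast
  then have *: "\<phi> i * (\<Prod>i'\<in>I - J. max 0 (\<phi> i - \<phi> i')) \<noteq> 0"
    using assms unfolding top_weight_def by (simp add: prod_zero_iff)
  then show "\<phi> i \<noteq> 0" by auto
  fix i' assume "i' \<in> I - J"
  then have "max 0 (\<phi> i - \<phi> i') \<noteq> 0" using * assms(1) by (auto simp: prod_zero_iff)
  then show "\<phi> i' < \<phi> i" by linarith
qed

text \<open>
  Two different sets of equal size would each contain an index that the other one ranks strictly lower.
\<close>
lemma top_weight_unique:
  assumes "finite I" "J \<subseteq> I" "J' \<subseteq> I" "card J = card J'"
    and "top_weight \<phi> I J \<noteq> 0" "top_weight \<phi> I J' \<noteq> 0"
  shows "J = J'"
proof (rule ccontr)
  assume "J \<noteq> J'"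
  have fin: "finite J" "finite J'" using assms finite_subset by blast+
  then obtain i i' where "i \<in> J - J'" "i' \<in> J' - J"
    using \<open>J \<noteq> J'\<close> assms(4) by (metis card_subset_eq Diff_eq_empty_iff all_not_in_conv)
  then have "\<phi> i' < \<phi> i" "\<phi> i < \<phi> i'"
    using top_weight_factor(2)[OF assms(1,2,5), of i i'] top_weight_factor(2)[OF assms(1,3,6), of i' i]
      subsetD[OF assms(2)] subsetD[OF assms(3)] by simp_all
  then show False by simp
qed

lemma top_weight_positive_set:
  assumes "finite I" "\<And>i. i \<in> I \<Longrightarrow> 0 \<le> \<phi> i"
  shows "top_weight \<phi> I {i \<in> I. 0 < \<phi> i} \<noteq> 0"
proof -
  have "\<phi> i * (\<Prod>i'\<in>I - {i \<in> I. 0 < \<phi> i}. max 0 (\<phi> i - \<phi> i')) \<noteq> 0"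
    if i: "i \<in> {i \<in> I. 0 < \<phi> i}" for i
  proof -
    have "max 0 (\<phi> i - \<phi> i') \<noteq> 0" if "i' \<in> I - {i \<in> I. 0 < \<phi> i}" for i'
      using that i by auto
    then have "(\<Prod>i'\<in>I - {i \<in> I. 0 < \<phi> i}. max 0 (\<phi> i - \<phi> i')) \<noteq> 0"
      using assms(1) by (simp add: prod_zero_iff)
    then show ?thesis using i by simp
  qed
  then show ?thesis unfolding top_weight_def using assms(1) by (simp add: prod_zero_iff)
qed

section \<open>Functionals cutting out the hull of maps with disjoint supports\<close>

lemma sum_fun_apply: "(\<Sum>i\<in>A. f i) v = (\<Sum>i\<in>A. f i v)"
  for f :: "'c \<Rightarrow> 'a \<Rightarrow> 'b::comm_monoid_add"
  by (induction A rule: infinite_finite_induct) auto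

lemma std_simplex_nonneg: "\<tau> \<in> std_simplex V \<Longrightarrow> 0 \<le> \<tau> v"
  by (cases "v \<in> V") (auto simp: std_simplex_def maps_on_def)

text \<open>
  Choose one vertex in the support of each \<open>\<tau>\<close> in \<open>T\<close>. The remaining \<open>d\<close> vertices give the functionals:
  inside the support of \<open>\<tau>\<close> they force \<open>t\<close> to be proportional to \<open>\<tau>\<close>, and outside all supports
  they force it to be zero. As the supports are disjoint, the absolute value of
  \<open>t = (\<Sum>\<tau>\<in>T. c \<tau> * \<tau>)\<close> is \<open>(\<Sum>\<tau>\<in>T. \<bar>c \<tau>\<bar> * \<tau>)\<close>, which lies in the cone over the hull.
\<close>
lemma odd_functionals_cutting_out_hull:
  fixes V :: "'a set"
  assumes V: "finite V" and T: "T \<in> disj_supp_sets d V"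
  obtains f :: "nat \<Rightarrow> ('a \<Rightarrow> real) \<Rightarrow> real"
  where "\<And>r. continuous_on UNIV (f r)" "\<And>r t. f r (\<lambda>v. - t v) = - f r t"
    "\<And>t. t \<in> maps_on V \<Longrightarrow> 0 < (\<Sum>u\<in>V. \<bar>t u\<bar>) \<Longrightarrow> \<forall>r<d. f r t = 0 \<Longrightarrow>
      (\<lambda>v. \<bar>t v\<bar> / (\<Sum>u\<in>V. \<bar>t u\<bar>)) \<in> convex hull T"
proof -
  have fT: "finite T" and TS: "T \<subseteq> std_simplex V" and cT: "card T + d = card V"
    using T by (auto simp: disj_supp_sets_def)
  have nz: "v \<in> V" if "\<tau> \<in> T" "\<tau> v \<noteq> 0" for \<tau> v
    using that TS by (auto simp: std_simplex_def maps_on_def)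
  have uniq: "\<tau> = \<tau>'" if "\<tau> \<in> T" "\<tau>' \<in> T" "\<tau> v \<noteq> 0" "\<tau>' v \<noteq> 0" for \<tau> \<tau>' v
    using that T nz[OF that(1,3)]
    by (auto simp: disj_supp_sets_def pairwise_def disjnt_def support_on_def)
  have "\<exists>v. \<tau> v \<noteq> 0" if "\<tau> \<in> T" for \<tau>
  proof (rule ccontr)
    assume "\<not> ?thesis"
    then have "(\<Sum>v\<in>V. \<tau> v) = 0" by simp
    then show False using that TS by (auto simp: std_simplex_def)
  qed
  then obtain g where g: "\<And>\<tau>. \<tau> \<in> T \<Longrightarrow> \<tau> (g \<tau>) \<noteq> 0" by metis
  have gpos: "0 < \<tau> (g \<tau>)" if "\<tau> \<in> T" for \<tau>
    using g[OF that] std_simplex_nonneg[of \<tau> V "g \<tau>"] that TS by (metis order_less_le subsetD)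
  have inj: "inj_on g T" using uniq g by (intro inj_onI) metis
  define W where "W = V - g ` T"
  have "card W = card V - card (g ` T)"
    unfolding W_def using fT nz g by (intro card_Diff_subset) auto
  then have "card W = d" using cT card_image[OF inj] by simp
  then obtain w where w: "bij_betw w {0..<d} W"
    using ex_bij_betw_nat_finite[of W] V by (auto simp: W_def)
  define \<sigma> where "\<sigma> v = (SOME \<tau>. \<tau> \<in> T \<and> \<tau> v \<noteq> 0)" for v
  have \<sigma>: "\<sigma> v = \<tau>" if "\<tau> \<in> T" "\<tau> v \<noteq> 0" for \<tau> v
    unfolding \<sigma>_def using that uniq by (intro some_equality) blast+
  define F where "F v t = (if \<exists>\<tau>\<in>T. \<tau> v \<noteq> 0 then t v * \<sigma> v (g (\<sigma> v)) - t (g (\<sigma> v)) * \<sigma> v v else t v)"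
    for v and t :: "'a \<Rightarrow> real"
  show ?thesis
  proof (rule that[of "\<lambda>r. F (w r)"])
    show "continuous_on UNIV (F (w r))" for r
      unfolding F_def
      by (cases "\<exists>\<tau>\<in>T. \<tau> (w r) \<noteq> 0")
        (simp_all add: continuous_on_diff continuous_on_mult_right)
    show "F (w r) (\<lambda>v. - t v) = - F (w r) t" for r t
      by (simp add: F_def)
    fix t :: "'a \<Rightarrow> real"
    assume t: "t \<in> maps_on V" and pos: "0 < (\<Sum>u\<in>V. \<bar>t u\<bar>)" and F0: "\<forall>r<d. F (w r) t = 0"
    have W0: "F v t = 0" if "v \<in> W" for v
      using F0 w that unfolding bij_betw_def by (metis atLeastLessThan_iff imageE)
    define c where "c \<tau> = \<bar>t (g \<tau>)\<bar> / \<tau> (g \<tau>)" for \<tau>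
    have c0: "0 \<le> c \<tau>" if "\<tau> \<in> T" for \<tau> using gpos[OF that] by (simp add: c_def)
    have abs_t: "\<bar>t v\<bar> = (\<Sum>\<tau>\<in>T. c \<tau> * \<tau> v)" for v
    proof (cases "\<exists>\<tau>\<in>T. \<tau> v \<noteq> 0")
      case True
      then obtain \<tau> where \<tau>: "\<tau> \<in> T" "\<tau> v \<noteq> 0" by blast
      have "(\<Sum>\<tau>'\<in>T. c \<tau>' * \<tau>' v) = (\<Sum>\<tau>'\<in>{\<tau>}. c \<tau>' * \<tau>' v)"
        using \<tau> uniq fT by (intro sum.mono_neutral_right) auto
      moreover have "t v * \<tau> (g \<tau>) = t (g \<tau>) * \<tau> v"
      proof (cases "v \<in> W")
        case True
        then show ?thesis using W0[OF True] \<tau> \<sigma>[OF \<tau>] unfolding F_def by (metis eq_iff_diff_eq_0)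
      next
        case False
        then obtain \<tau>' where \<tau>': "\<tau>' \<in> T" "v = g \<tau>'" using nz[OF \<tau>] by (auto simp: W_def)
        then have "\<tau>' = \<tau>" using uniq[OF \<tau>'(1) \<tau>(1)] g[OF \<tau>'(1)] \<tau> by auto
        then show ?thesis using \<tau>' by simp
      qed
      then have "\<bar>t v\<bar> * \<tau> (g \<tau>) = \<bar>t (g \<tau>)\<bar> * \<tau> v"
        using gpos[OF \<tau>(1)] std_simplex_nonneg[of \<tau> V v] \<tau>(1) TS
        by (metis abs_mult abs_of_nonneg abs_of_pos subsetD)
      then have "\<bar>t v\<bar> = c \<tau> * \<tau> v" using gpos[OF \<tau>(1)] by (simp add: c_def field_simps)
      ultimately show ?thesis by simp
    next
      case False
      have "t v = 0"
      proof (cases "v \<in> V")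
        case True
        then have "v \<in> W" using False g by (auto simp: W_def)
        then show ?thesis using W0[of v] False by (simp add: F_def)
      next
        case False
        then show ?thesis using t by (auto simp: maps_on_def)
      qed
      moreover have "(\<Sum>\<tau>\<in>T. c \<tau> * \<tau> v) = 0" using False by (intro sum.neutral) auto
      ultimately show ?thesis by simp
    qed
    have S: "(\<Sum>u\<in>V. \<bar>t u\<bar>) = sum c T"
    proof -
      have "(\<Sum>u\<in>V. \<bar>t u\<bar>) = (\<Sum>\<tau>\<in>T. c \<tau> * (\<Sum>u\<in>V. \<tau> u))"
        unfolding abs_t by (subst sum.swap) (simp add: sum_distrib_left)
      also have "\<dots> = sum c T"
        using TS by (intro sum.cong) (auto simp: std_simplex_def)
      finally show ?thesis .
    qed
    show "(\<lambda>v. \<bar>t v\<bar> / (\<Sum>u\<in>V. \<bar>t u\<bar>)) \<in> convex hull T"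
      unfolding convex_hull_finite[OF fT] mem_Collect_eq
    proof (intro exI[of _ "\<lambda>\<tau>. c \<tau> / sum c T"] conjI ballI)
      show "0 \<le> c \<tau> / sum c T" if "\<tau> \<in> T" for \<tau> using c0 that by (simp add: sum_nonneg)
      show "(\<Sum>\<tau>\<in>T. c \<tau> / sum c T) = 1"
        using pos S by (simp flip: sum_divide_distrib)
      show "(\<Sum>\<tau>\<in>T. (c \<tau> / sum c T) *\<^sub>R \<tau>) = (\<lambda>v. \<bar>t v\<bar> / (\<Sum>u\<in>V. \<bar>t u\<bar>))"
        unfolding S by (rule ext) (simp add: sum_fun_apply scaleR_fun_def abs_t sum_divide_distrib)
    qed
  qed
qed

section \<open>From the cube to signed maps on the vertex sets\<close>

text \<open>
  The hemisphere of signed maps on \<open>insert v0 W\<close> that are nonnegative at \<open>v0\<close>, up to positive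
  scaling: block \<open>l\<close> supplies the values on \<open>W\<close> through \<open>e\<close>, and the product vanishes exactly when the
  block lies on the boundary of its cube, so that the boundary goes to the equator.
\<close>
definition simplex_lift :: "nat \<Rightarrow> (nat \<Rightarrow> nat) \<Rightarrow> nat \<Rightarrow> 'a set \<Rightarrow> 'a \<Rightarrow> ('a \<Rightarrow> nat) \<Rightarrow>
    (nat \<Rightarrow> real) \<Rightarrow> 'a \<Rightarrow> real" where
  "simplex_lift N b l W v0 e x v =
    (if v \<in> W then x (e v) else if v = v0 then (\<Prod>j | j < N \<and> b j = l. 1 - \<bar>x j\<bar>) else 0)"

lemma continuous_simplex_lift: "continuous_on UNIV (simplex_lift N b l W v0 e)"
proof (rule continuous_on_coordinatewise_then_product)
  fix v
  show "continuous_on UNIV (\<lambda>x. simplex_lift N b l W v0 e x v)"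
    unfolding simplex_lift_def
    by (cases "v \<in> W"; cases "v = v0") (auto intro!: continuous_intros)
qed

lemma abs_simplex_lift_abs:
  "\<bar>simplex_lift N b l W v0 e (\<lambda>j. \<bar>x j\<bar>) v\<bar> = \<bar>simplex_lift N b l W v0 e x v\<bar>"
  by (simp add: simplex_lift_def)

lemma simplex_lift_flip_same:
  assumes "e ` W \<subseteq> {j. j < N \<and> b j = l}" "j < N" "b j = l" "\<bar>x j\<bar> = 1"
  shows "simplex_lift N b l W v0 e (block_flip b l x) = (\<lambda>v. - simplex_lift N b l W v0 e x v)"
proof -
  have "(\<Prod>j | j < N \<and> b j = l. 1 - \<bar>y j\<bar>) = 0" if "\<bar>y j\<bar> = 1" for y :: "nat \<Rightarrow> real"
    using assms that by (intro prod_zero) auto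
  from this[of x] this[of "block_flip b l x"] show ?thesis
    using assms by (auto simp: simplex_lift_def fun_eq_iff block_flip_def)
qed

lemma simplex_lift_flip_other:
  assumes "e ` W \<subseteq> {j. j < N \<and> b j = l}" "l' \<noteq> l"
  shows "simplex_lift N b l W v0 e (block_flip b l' x) = simplex_lift N b l W v0 e x"
  using assms by (auto simp: simplex_lift_def fun_eq_iff block_flip_def intro!: prod.cong)

lemma sum_abs_simplex_lift_pos:
  assumes "finite W" "v0 \<notin> W" "e ` W = {j. j < N \<and> b j = l}"
  shows "0 < (\<Sum>v\<in>insert v0 W. \<bar>simplex_lift N b l W v0 e x v\<bar>)"
proof -
  have "\<exists>v\<in>insert v0 W. simplex_lift N b l W v0 e x v \<noteq> 0"
  proof (cases "\<exists>j. j < N \<and> b j = l \<and> x j \<noteq> 0")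
    case True
    then obtain j where j: "j \<in> e ` W" "x j \<noteq> 0" using assms by auto
    then show ?thesis by (auto simp: simplex_lift_def)
  next
    case False
    then have "(\<Prod>j | j < N \<and> b j = l. 1 - \<bar>x j\<bar>) = 1" by (intro prod.neutral) auto
    then show ?thesis using assms by (auto simp: simplex_lift_def)
  qed
  then obtain v where v: "v \<in> insert v0 W" "simplex_lift N b l W v0 e x v \<noteq> 0" by blast
  have "0 < \<bar>simplex_lift N b l W v0 e x v\<bar>" using v by simp
  also have "\<dots> \<le> (\<Sum>v\<in>insert v0 W. \<bar>simplex_lift N b l W v0 e x v\<bar>)"
    using v assms(1) by (intro member_le_sum) auto
  finally show ?thesis .
qed

lemma abs_in_cube: "x \<in> cube N \<Longrightarrow> (\<lambda>j. \<bar>x j\<bar>) \<in> cube N"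
  by (simp add: cube_def)

lemma continuous_on_abs_coordinates: "continuous_on S (\<lambda>x::nat \<Rightarrow> real. \<lambda>j. \<bar>x j\<bar>)"
  by (intro continuous_intros continuous_on_coordinatewise_then_product)
     (rule continuous_on_subset[OF continuous_on_product_coordinates], simp)

lemma abs_block_flip: "(\<lambda>j. \<bar>block_flip b l x j\<bar>) = (\<lambda>j. \<bar>x j\<bar>)" for x :: "nat \<Rightarrow> real"
  by (auto simp: block_flip_def)

section \<open>The covering theorem\<close>

theorem theorem3p3:
  fixes m :: nat
    and V :: "nat \<Rightarrow> 'a set"
    and d n :: "nat \<Rightarrow> nat"
    and I :: "'i set"
    and B :: "'i \<Rightarrow> (nat \<Rightarrow> 'a \<Rightarrow> real) set"
  defines "Y \<equiv> (\<Pi>\<^sub>E l\<in>{1..m}. std_simplex (V l))"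
  assumes "m \<ge> 1"
    and "\<And>l. l \<in> {1..m} \<Longrightarrow> finite (V l)"
    and "\<And>l. l \<in> {1..m} \<Longrightarrow> d l \<ge> 1"
    and "\<And>l. l \<in> {1..m} \<Longrightarrow> n l \<ge> 1"
    and "\<And>l. l \<in> {1..m} \<Longrightarrow> card (V l) = d l * n l + 1"
    and "finite I"
    and "\<And>i. i \<in> I \<Longrightarrow>
      closedin (product_topology (\<lambda>l. top_of_set (std_simplex (V l))) {1..m}) (B i)"
    and "(\<Union>i\<in>I. B i) = Y"
    and "\<And>y. y \<in> Y \<Longrightarrow> card {i \<in> I. y \<in> B i} \<le> (\<Sum>l=1..m. n l)"
  shows "\<exists>i\<in>I. \<exists>l\<in>{1..m}. \<forall>T\<in>disj_supp_sets (d l) (V l).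
           (\<lambda>y. y l) ` B i \<inter> convex hull T \<noteq> {}"
proof (rule ccontr)
  assume neg: "\<not> ?thesis"
  define L where "L = {1..m}"
  have finL: "finite L" by (simp add: L_def)
  note fV = assms(3)[folded L_def] and cV = assms(6)[folded L_def]
  note clB = assms(8)[folded L_def] and cov = assms(9) and mult = assms(10)[folded L_def]

  have neg': "\<forall>i\<in>I. \<forall>l\<in>L. \<exists>T\<in>disj_supp_sets (d l) (V l). (\<lambda>y. y l) ` B i \<inter> convex hull T = {}"
    using neg by (simp add: L_def)
  define escapes where "escapes i l f \<longleftrightarrow>
      (\<forall>r. continuous_on UNIV (f r)) \<and> (\<forall>r t. f r (\<lambda>v. - t v) = - f r t) \<and>
      (\<forall>t\<in>maps_on (V l). 0 < (\<Sum>u\<in>V l. \<bar>t u\<bar>) \<longrightarrow> (\<forall>r<d l. f r t = 0) \<longrightarrow>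
        (\<lambda>v. \<bar>t v\<bar> / (\<Sum>u\<in>V l. \<bar>t u\<bar>)) \<notin> (\<lambda>y. y l) ` B i)"
    for i l and f :: "nat \<Rightarrow> ('a \<Rightarrow> real) \<Rightarrow> real"
  have "\<exists>f. escapes i l f" if i: "i \<in> I" and l: "l \<in> L" for i l
  proof -
    obtain T where T: "T \<in> disj_supp_sets (d l) (V l)" "(\<lambda>y. y l) ` B i \<inter> convex hull T = {}"
      using bspec[OF bspec[OF neg' i] l] by (rule bexE)
    obtain f :: "nat \<Rightarrow> ('a \<Rightarrow> real) \<Rightarrow> real"
      where f: "\<And>r. continuous_on UNIV (f r)" "\<And>r t. f r (\<lambda>v. - t v) = - f r t"
        "\<And>t. t \<in> maps_on (V l) \<Longrightarrow> 0 < (\<Sum>u\<in>V l. \<bar>t u\<bar>) \<Longrightarrow> \<forall>r<d l. f r t = 0 \<Longrightarrow>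
          (\<lambda>v. \<bar>t v\<bar> / (\<Sum>u\<in>V l. \<bar>t u\<bar>)) \<in> convex hull T"
      by (rule odd_functionals_cutting_out_hull[OF fV[OF l] T(1)]) (rule that)
    have "x \<notin> (\<lambda>y. y l) ` B i" if "x \<in> convex hull T" for x
      using that T(2) by blast
    with f have "escapes i l f" unfolding escapes_def by simp
    then show ?thesis by blast
  qed
  then obtain f where f: "\<And>i l. i \<in> I \<Longrightarrow> l \<in> L \<Longrightarrow> escapes i l (f i l)" by metis
  have f_cont: "continuous_on UNIV (f i l r)" and f_odd: "f i l r (\<lambda>v. - t v) = - f i l r t"
    if "i \<in> I" "l \<in> L" for i l r t
    using f[OF that] by (simp_all add: escapes_def)
  have f_zero: "(\<lambda>v. \<bar>t v\<bar> / (\<Sum>u\<in>V l. \<bar>t u\<bar>)) \<notin> (\<lambda>y. y l) ` B i"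
    if "i \<in> I" "l \<in> L" "t \<in> maps_on (V l)" "0 < (\<Sum>u\<in>V l. \<bar>t u\<bar>)" "\<forall>r<d l. f i l r t = 0" for i l t
    using f[OF that(1,2)] that(3-5) by (simp add: escapes_def)

  \<comment> \<open>\<open>\<kappa>\<close> names each real function of the construction by a factor, one of the levels of that factor, and a
    functional; its first component also serves as the block labelling of the coordinates.\<close>
  define N where "N = (\<Sum>l\<in>L. n l * d l)"
  obtain \<kappa> where \<kappa>: "bij_betw \<kappa> {0..<N} (SIGMA l:L. {..<n l} \<times> {..<d l})"
    using ex_bij_betw_nat_finite[of "SIGMA l:L. {..<n l} \<times> {..<d l}"] finL
    by (auto simp: N_def card_cartesian_product)
  define b where "b j = fst (\<kappa> j)" for j
  have card_block: "card {j. j < N \<and> b j = l} = n l * d l" if "l \<in> L" for l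
  proof -
    have img: "\<kappa> ` {j. j < N \<and> b j = l} = {l} \<times> ({..<n l} \<times> {..<d l})"
    proof (intro equalityI subsetI)
      fix z assume "z \<in> \<kappa> ` {j. j < N \<and> b j = l}"
      then obtain j where j: "z = \<kappa> j" "j < N" "fst (\<kappa> j) = l" by (auto simp: b_def)
      have "\<kappa> j \<in> (SIGMA l:L. {..<n l} \<times> {..<d l})" using bij_betw_apply[OF \<kappa>, of j] j(2) by simp
      then show "z \<in> {l} \<times> ({..<n l} \<times> {..<d l})" using j by auto
    next
      fix z assume z: "z \<in> {l} \<times> ({..<n l} \<times> {..<d l})"
      then have "z \<in> \<kappa> ` {0..<N}" using \<kappa> that by (auto simp: bij_betw_def)
      then obtain j where j: "j < N" "z = \<kappa> j" by auto
      with z have "b j = l" by (auto simp: b_def mem_Times_iff)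
      with j show "z \<in> \<kappa> ` {j. j < N \<and> b j = l}" by blast
    qed
    have "inj_on \<kappa> {j. j < N \<and> b j = l}"
      by (rule inj_on_subset[OF bij_betw_imp_inj_on[OF \<kappa>]]) auto
    from card_image[OF this] show ?thesis by (simp add: img card_cartesian_product)
  qed
  have "\<exists>v. v \<in> V l" if "l \<in> L" for l using cV[OF that] by (cases "V l = {}") auto
  then obtain v0 where v0: "\<And>l. l \<in> L \<Longrightarrow> v0 l \<in> V l" by metis
  define W where "W l = V l - {v0 l}" for l
  have Vl: "V l = insert (v0 l) (W l)" "v0 l \<notin> W l" "finite (W l)" if "l \<in> L" for l
    using v0[OF that] fV[OF that] by (auto simp: W_def)
  have "\<exists>e. bij_betw e (W l) {j. j < N \<and> b j = l}" if "l \<in> L" for l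
  proof (rule finite_same_card_bij)
    show "finite (W l)" by (rule Vl(3)[OF that])
    have "card (W l) = n l * d l"
      using cV[OF that] v0[OF that] fV[OF that] by (simp add: W_def)
    then show "card (W l) = card {j. j < N \<and> b j = l}" using card_block[OF that] by simp
  qed simp
  then obtain e where e_bij: "\<And>l. l \<in> L \<Longrightarrow> bij_betw (e l) (W l) {j. j < N \<and> b j = l}" by metis
  have e: "e l ` W l = {j. j < N \<and> b j = l}" if "l \<in> L" for l
    using e_bij[OF that] by (simp add: bij_betw_def)
  \<comment> \<open>\<open>q\<close> gives each level of each factor its own size of index sets between \<open>1\<close> and \<open>n'\<close>.\<close>
  define n' where "n' = (\<Sum>l\<in>L. n l)"
  obtain q0 where "bij_betw q0 {1..n'} (SIGMA l:L. {..<n l})"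
    using ex_bij_betw_nat_finite_1[of "SIGMA l:L. {..<n l}"] finL by (auto simp: n'_def)
  then obtain q where q: "bij_betw q (SIGMA l:L. {..<n l}) {1..n'}"
    using bij_betw_inv by blast

  define t where "t l = simplex_lift N b l (W l) (v0 l) (e l)" for l
  have t_maps: "t l x \<in> maps_on (V l)" if "l \<in> L" for l x
    using Vl[OF that] by (auto simp: t_def simplex_lift_def maps_on_def)
  have t_pos: "0 < (\<Sum>u\<in>V l. \<bar>t l x u\<bar>)" if "l \<in> L" for l x
    unfolding t_def Vl(1)[OF that]
    by (rule sum_abs_simplex_lift_pos[OF Vl(3,2)[OF that] e[OF that]])
  have t_abs: "\<bar>t l (\<lambda>j. \<bar>x j\<bar>) v\<bar> = \<bar>t l x v\<bar>" for l x v
    unfolding t_def by (rule abs_simplex_lift_abs)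
  have t_cont: "continuous_on S (t l)" for S l
    unfolding t_def by (rule continuous_on_subset[OF continuous_simplex_lift]) simp

  define y where "y x = (\<lambda>l\<in>L. \<lambda>v. \<bar>t l x v\<bar> / (\<Sum>u\<in>V l. \<bar>t l x u\<bar>))" for x
  have y_l: "y x l \<in> std_simplex (V l)" if "l \<in> L" for x l
    using t_pos[OF that, of x] t_maps[OF that, of x] that
    by (auto simp: y_def std_simplex_def maps_on_def sum_nonneg simp flip: sum_divide_distrib)
  have yY: "y x \<in> Y" for x
    using y_l unfolding Y_def L_def[symmetric] by (auto simp: PiE_iff y_def)
  have y_abs: "y (\<lambda>j. \<bar>x j\<bar>) = y x" for x
    by (simp add: y_def t_abs)
  have y_cont: "continuous_map (top_of_set (cube N))
      (product_topology (\<lambda>l. top_of_set (std_simplex (V l))) L) y"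
    unfolding continuous_map_componentwise
  proof (intro conjI ballI)
    show "y ` topspace (top_of_set (cube N)) \<subseteq> extensional L" by (auto simp: y_def)
    fix l assume l: "l \<in> L"
    have tv: "continuous_on (cube N) (\<lambda>x. t l x v)" for v
      using continuous_on_product_then_coordinatewise[OF t_cont] .
    have "continuous_on (cube N) (\<lambda>x. y x l)"
    proof (rule continuous_on_coordinatewise_then_product)
      fix v
      show "continuous_on (cube N) (\<lambda>x. y x l v)"
        using l t_pos[OF l] by (auto simp: y_def intro!: continuous_intros tv) (metis less_irrefl)
    qed
    then show "continuous_map (top_of_set (cube N)) (top_of_set (std_simplex (V l))) (\<lambda>x. y x l)"
      using y_l[OF l] by (auto intro!: continuous_map_into_subtopology)
  qed

  \<comment> \<open>As \<open>y x\<close> depends only on \<open>\<bar>x\<bar>\<close>, the sets and the distances to them can be evaluated at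
    \<open>\<bar>x\<bar>\<close>; this makes the weights below invariant under all block flips. Empty sets are
    dropped because \<^const>\<open>infdist\<close> to the empty set is zero.\<close>
  define C where "C i = {x \<in> cube N. y x \<in> B i}" for i
  have closed_C: "closed (C i)" if "i \<in> I" for i
  proof -
    have "closedin (top_of_set (cube N)) (C i)"
      using closedin_continuous_map_preimage[OF y_cont clB[OF that]] by (simp add: C_def)
    then show ?thesis
      using compact_cube compact_imp_closed closedin_closed_trans by blast
  qed
  define I' where "I' = {i \<in> I. C i \<noteq> {}}"
  have I': "finite I'" "\<And>i. i \<in> I' \<Longrightarrow> i \<in> I" "\<And>i. i \<in> I' \<Longrightarrow> closed (C i)" "\<And>i. i \<in> I' \<Longrightarrow> C i \<noteq> {}"
    using assms(7) closed_C by (auto simp: I'_def)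
  define Z where "Z i l = {x \<in> cube N. \<forall>r\<in>{..<d l}. f i l r (t l x) = 0}" for i l

  have ev1: "\<forall>\<^sub>F \<epsilon> in at_right 0. \<forall>x\<in>cube N. card {i \<in> I'. infdist x (C i) < \<epsilon>} \<le> n'"
  proof (rule eventually_thickening_multiplicity[OF compact_cube I'(1,3,4)])
    fix x assume "x \<in> cube N"
    have "card {i \<in> I'. x \<in> C i} \<le> card {i \<in> I. y x \<in> B i}"
      using assms(7) by (intro card_mono) (auto simp: I'_def C_def)
    also have "\<dots> \<le> n'" using mult[OF yY] by (simp add: n'_def)
    finally show "card {i \<in> I'. x \<in> C i} \<le> n'" .
  qed
  have "\<forall>\<^sub>F \<epsilon> in at_right 0. \<forall>x\<in>Z i l. \<epsilon> < infdist (\<lambda>j. \<bar>x j\<bar>) (C i)" if i: "i \<in> I'" and l: "l \<in> L" for i l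
  proof (rule compact_pos_bound)
    have "continuous_on (cube N) (\<lambda>x. f i l r (t l x))" for r
      by (rule continuous_on_compose2[OF f_cont[OF I'(2)[OF i] l] t_cont]) auto
    then have "closed {x \<in> cube N. f i l r (t l x) = 0}" for r
      by (intro continuous_closed_preimage_constant compact_imp_closed compact_cube)
    then have "closed (\<Inter>r\<in>{..<d l}. {x \<in> cube N. f i l r (t l x) = 0})" by blast
    moreover have "Z i l = cube N \<inter> (\<Inter>r\<in>{..<d l}. {x \<in> cube N. f i l r (t l x) = 0})"
      by (auto simp: Z_def)
    ultimately show "compact (Z i l)" by (simp only: compact_Int_closed[OF compact_cube])
    show "continuous_on (Z i l) (\<lambda>x. infdist (\<lambda>j. \<bar>x j\<bar>) (C i))"
      by (intro continuous_on_infdist continuous_on_abs_coordinates)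
    fix x assume x: "x \<in> Z i l"
    have "y x l \<notin> (\<lambda>y. y l) ` B i"
      using f_zero[OF I'(2)[OF i] l t_maps[OF l] t_pos[OF l], of x] x l by (auto simp: Z_def y_def)
    then have "(\<lambda>j. \<bar>x j\<bar>) \<notin> C i" by (auto simp: C_def y_abs)
    then show "0 < infdist (\<lambda>j. \<bar>x j\<bar>) (C i)" using I'(3,4)[OF i] infdist_pos_not_in_closed by blast
  qed
  then have ev2: "\<forall>\<^sub>F \<epsilon> in at_right 0. \<forall>i\<in>I'. \<forall>l\<in>L. \<forall>x\<in>Z i l. \<epsilon> < infdist (\<lambda>j. \<bar>x j\<bar>) (C i)"
    by (intro eventually_ball_finite[OF I'(1)] eventually_ball_finite[OF finL] ballI)
  have "\<forall>\<^sub>F \<epsilon>::real in at_right 0. 0 < \<epsilon>" by (simp add: eventually_at_right_less)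
  then have ev: "\<forall>\<^sub>F \<epsilon> in at_right 0. 0 < \<epsilon> \<and>
      (\<forall>x\<in>cube N. card {i \<in> I'. infdist x (C i) < \<epsilon>} \<le> n') \<and>
      (\<forall>i\<in>I'. \<forall>l\<in>L. \<forall>x\<in>Z i l. \<epsilon> < infdist (\<lambda>j. \<bar>x j\<bar>) (C i))"
    by (intro eventually_conj ev1 ev2)
  obtain \<epsilon> :: real where \<epsilon>: "0 < \<epsilon>"
    and \<epsilon>_mult: "\<And>x. x \<in> cube N \<Longrightarrow> card {i \<in> I'. infdist x (C i) < \<epsilon>} \<le> n'"
    and \<epsilon>_Z: "\<And>i l x. i \<in> I' \<Longrightarrow> l \<in> L \<Longrightarrow> x \<in> Z i l \<Longrightarrow> \<epsilon> < infdist (\<lambda>j. \<bar>x j\<bar>) (C i)"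
    using eventually_happens'[OF trivial_limit_at_right_real ev] by blast

  \<comment> \<open>The radius \<open>\<epsilon>\<close> keeps the multiplicity at most \<open>n'\<close> and keeps each thickened set away from the common
    zeros of its functionals.\<close>
  define \<phi> where "\<phi> x i = max 0 (\<epsilon> - infdist (\<lambda>j. \<bar>x j\<bar>) (C i))" for x i
  have \<phi>_cont: "continuous_on S (\<lambda>x. \<phi> x i)" for S i
    unfolding \<phi>_def by (intro continuous_intros continuous_on_infdist continuous_on_abs_coordinates)
  define \<iota> where "\<iota> J = (SOME i. i \<in> J)" for J :: "'i set"
  have \<iota>: "\<iota> J \<in> J" if "J \<noteq> {}" for J using that by (simp add: \<iota>_def some_in_eq)
  define G where "G k x = (\<Sum>J | J \<subseteq> I' \<and> J \<noteq> {} \<and> card J = q (fst (\<kappa> k), fst (snd (\<kappa> k))).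
      top_weight (\<phi> x) I' J * f (\<iota> J) (b k) (snd (snd (\<kappa> k))) (t (b k) x))" for k x
  have bL: "b k \<in> L" if "k < N" for k
    using bij_betw_apply[OF \<kappa>, of k] that by (auto simp: b_def)

  have "\<exists>x\<in>cube N. \<forall>k<N. G k x = 0"
  proof (rule block_Borsuk_Ulam[of N G b])
    fix k assume k: "k < N"
    have "continuous_on (cube N) (\<lambda>x. top_weight (\<phi> x) I' J)" for J
      unfolding top_weight_def
      by (intro continuous_on_prod continuous_on_mult continuous_on_max continuous_on_const
          continuous_on_diff \<phi>_cont)
    moreover have "continuous_on (cube N) (\<lambda>x. f (\<iota> J) (b k) r (t (b k) x))"
      if "J \<subseteq> I'" "J \<noteq> {}" for J r
      by (rule continuous_on_compose2[OF f_cont t_cont]) (use \<iota>[OF that(2)] that I' bL[OF k] in auto)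
    ultimately show "continuous_on (cube N) (G k)"
      unfolding G_def by (intro continuous_on_sum continuous_on_mult) auto
  next
    fix k j x assume k: "k < N" and j: "j < N" and x: "x \<in> cube N" "\<bar>x j\<bar> = 1"
    have \<phi>: "\<phi> (block_flip b (b j) x) = \<phi> x"
      by (rule ext) (simp only: \<phi>_def abs_block_flip)
    have odd: "f (\<iota> J) (b k) r (t (b k) (block_flip b (b j) x)) =
        (if b k = b j then - f (\<iota> J) (b k) r (t (b k) x) else f (\<iota> J) (b k) r (t (b k) x))"
      if "J \<subseteq> I'" "J \<noteq> {}" for J r
    proof (cases "b k = b j")
      case True
      have "t (b k) (block_flip b (b k) x) = (\<lambda>v. - t (b k) x v)"
        unfolding t_def using e[OF bL[OF k]] j True x(2) by (intro simplex_lift_flip_same[of _ _ _ _ _ j]) auto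
      then show ?thesis
        using True f_odd[of "\<iota> J" "b k"] \<iota>[OF that(2)] that I' bL[OF k] by auto
    next
      case False
      then have "t (b k) (block_flip b (b j) x) = t (b k) x"
        unfolding t_def using e[OF bL[OF k]] by (intro simplex_lift_flip_other) auto
      then show ?thesis using False by simp
    qed
    show "G k (block_flip b (b j) x) = (if b k = b j then - G k x else G k x)"
      unfolding G_def \<phi> by (auto simp: odd sum_negf)
  qed

  then obtain x where x: "x \<in> cube N" "\<And>k. k < N \<Longrightarrow> G k x = 0" by blast
  \<comment> \<open>At the common zero \<open>x\<close>, the set of all indices with positive \<open>\<phi>\<close> is the only one of its size with nonzero
    weight. The functions of its level reduce to the functionals of the chosen index, which therefore all vanish,
    although \<open>x\<close> lies in the thickened set of that index.\<close>
  define J where "J = {i \<in> I'. 0 < \<phi> x i}"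
  have J: "J \<subseteq> I'" by (auto simp: J_def)
  have wJ: "top_weight (\<phi> x) I' J \<noteq> 0"
    unfolding J_def by (intro top_weight_positive_set I') (simp add: \<phi>_def)
  have "J \<noteq> {}"
  proof -
    obtain i where i: "i \<in> I" "y x \<in> B i" using yY[of x] cov by auto
    then have "(\<lambda>j. \<bar>x j\<bar>) \<in> C i" using x(1) by (simp add: C_def y_abs abs_in_cube)
    then have "i \<in> J" using i \<epsilon> by (auto simp: J_def I'_def \<phi>_def)
    then show ?thesis by blast
  qed
  have "card J \<le> n'"
  proof -
    have "J = {i \<in> I'. infdist (\<lambda>j. \<bar>x j\<bar>) (C i) < \<epsilon>}"
      by (auto simp: J_def \<phi>_def)
    then show ?thesis using \<epsilon>_mult[OF abs_in_cube[OF x(1)]] by simp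
  qed
  moreover have "0 < card J" using \<open>J \<noteq> {}\<close> J I'(1) by (meson card_gt_0_iff finite_subset)
  ultimately have "card J \<in> {1..n'}" by auto
  then have "card J \<in> q ` (SIGMA l:L. {..<n l})" using q by (simp add: bij_betw_def)
  then obtain l s where l: "l \<in> L" "s < n l" "card J = q (l, s)" by auto
  have "f (\<iota> J) l r (t l x) = 0" if r: "r < d l" for r
  proof -
    have "(l, s, r) \<in> \<kappa> ` {0..<N}" using \<kappa> l r by (auto simp: bij_betw_def)
    then obtain k where k: "k < N" "\<kappa> k = (l, s, r)" by force
    let ?A = "{J'. J' \<subseteq> I' \<and> J' \<noteq> {} \<and> card J' = q (l, s)}"
    have "0 = G k x" using x(2)[OF k(1)] by simp
    also have "\<dots> = (\<Sum>J'\<in>?A. top_weight (\<phi> x) I' J' * f (\<iota> J') l r (t l x))"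
      by (simp add: G_def k b_def)
    also have "\<dots> = (\<Sum>J'\<in>{J}. top_weight (\<phi> x) I' J' * f (\<iota> J') l r (t l x))"
    proof (rule sum.mono_neutral_right)
      show "finite ?A" using I'(1) by simp
      show "{J} \<subseteq> ?A" using J l \<open>J \<noteq> {}\<close> by auto
      show "\<forall>J'\<in>?A - {J}. top_weight (\<phi> x) I' J' * f (\<iota> J') l r (t l x) = 0"
        using top_weight_unique[OF I'(1) _ J _ _ wJ] l by force
    qed
    finally show ?thesis using wJ by simp
  qed
  then have "x \<in> Z (\<iota> J) l" using x(1) by (auto simp: Z_def)
  moreover have "\<iota> J \<in> J" by (rule \<iota>[OF \<open>J \<noteq> {}\<close>])
  ultimately show False
    using \<epsilon>_Z[of "\<iota> J" l x] l(1) by (auto simp: J_def \<phi>_def)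
qed

end
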